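(* Let $\mathbf{k}=(k_0,\dots,k_n)$ and $\mathbf{r}=(r_1,\dots,r_n)$ be positive integers, $r_0=r_{n+1}=1$, with $r_i\le r_{i-1}k_{i-1}$ and $r_i\le r_{i+1}k_i$ for $i=1,\dots,n$. The tensor train variety $V_{\mathbf{k},\mathbf{r}}$ has dimension $$\dim(V_{\mathbf{k},\mathbf{r}})=\left(\sum_{i=0}^{n-1}(r_ik_i-r_{i+1})\cdot r_{i+1}\right)+r_nk_n-1.$$
   Context: The tensor train variety $V_{\mathbf{k},\mathbf{r}}\subseteq\mathbb{P}\left(\bigotimes_{i=0}^n\mathbb{C}^{k_i}\right)$ is the Zariski closure of the set of (classes of nonzero) tensors $\psi$ with entries $\psi_{j_0,\dots,j_n}=A_0^{(j_0)}A_1^{(j_1)}\cdots A_n^{(j_n)}$, $1\le j_i\le k_i$, where $A_i^{(j)}$ ($0\le i\le n$, $1\le j\le k_i$) are arbitrary complex $r_i\times r_{i+1}$ matrices. Equivalently, it is the set of $\psi$ whose flattening $\psi^i$ of size $(k_0\cdots k_i)\times(k_{i+1}\cdots k_n)$ has rank at most $r_{i+1}$ for $i=0,\dots,n-1$. Dimension is as a projective variety. *)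

theory Defs
  imports
    "HOL-Analysis.Analysis"
    "HOL-Library.Poly_Mapping"
    "Jordan_Normal_Form.Matrix"
begin

section \<open>Polynomials and projective space over the complex numbers\<close>

text \<open>
  A polynomial in variables indexed by \<open>'i\<close> is a finitely supported map from exponents
  (finitely supported maps from variables to \<open>nat\<close>) to coefficients.
\<close>

type_synonym 'i cpoly = "('i \<Rightarrow>\<^sub>0 nat) \<Rightarrow>\<^sub>0 complex"

definition monom_eval :: "('i \<Rightarrow>\<^sub>0 nat) \<Rightarrow> ('i \<Rightarrow> complex) \<Rightarrow> complex" where
  "monom_eval m v = (\<Prod>i\<in>Poly_Mapping.keys m. v i ^ Poly_Mapping.lookup m i)"

definition poly_eval :: "'i cpoly \<Rightarrow> ('i \<Rightarrow> complex) \<Rightarrow> complex" where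
  "poly_eval p v = (\<Sum>m\<in>Poly_Mapping.keys p. Poly_Mapping.lookup p m * monom_eval m v)"

definition monom_deg :: "('i \<Rightarrow>\<^sub>0 nat) \<Rightarrow> nat" where
  "monom_deg m = (\<Sum>i\<in>Poly_Mapping.keys m. Poly_Mapping.lookup m i)"

text \<open>Homogeneous polynomials of degree \<open>d\<close> (including \<open>0\<close>) in the variables \<open>I\<close>.\<close>

definition homogeneous :: "'i set \<Rightarrow> nat \<Rightarrow> 'i cpoly \<Rightarrow> bool" where
  "homogeneous I d p \<longleftrightarrow> (\<forall>m\<in>Poly_Mapping.keys p. Poly_Mapping.keys m \<subseteq> I \<and> monom_deg m = d)"

text \<open>
  The vector space with coordinates indexed by \<open>I\<close>; functions are normalised to be zero
  outside \<open>I\<close> so that vectors correspond to functions on \<open>I\<close>.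
\<close>

definition coord_space :: "'i set \<Rightarrow> ('i \<Rightarrow> complex) set" where
  "coord_space I = {v. \<forall>i. i \<notin> I \<longrightarrow> v i = 0}"

text \<open>The class of a vector in projective space is the set of all its nonzero multiples.\<close>

definition proj_class :: "('i \<Rightarrow> complex) \<Rightarrow> ('i \<Rightarrow> complex) set" where
  "proj_class v = {(\<lambda>i. c * v i) | c. c \<noteq> 0}"

definition proj_space :: "'i set \<Rightarrow> ('i \<Rightarrow> complex) set set" where
  "proj_space I = proj_class ` (coord_space I - {\<lambda>_. 0})"

definition proj_zeros :: "'i set \<Rightarrow> 'i cpoly set \<Rightarrow> ('i \<Rightarrow> complex) set set" where
  "proj_zeros I F = {P \<in> proj_space I. \<forall>p\<in>F. \<forall>v\<in>P. poly_eval p v = 0}"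

definition zariski :: "'i set \<Rightarrow> ('i \<Rightarrow> complex) set topology" where
  "zariski I = topology (\<lambda>U. \<exists>F. (\<forall>p\<in>F. \<exists>d. homogeneous I d p) \<and>
                                 U = proj_space I - proj_zeros I F)"

lemma poly_eval_superset:
  assumes "finite S" "Poly_Mapping.keys p \<subseteq> S"
  shows "poly_eval p v = (\<Sum>m\<in>S. Poly_Mapping.lookup p m * monom_eval m v)"
  unfolding poly_eval_def using assms
  by (intro sum.mono_neutral_left) (auto simp: in_keys_iff)

lemma poly_eval_add: "poly_eval (p + q) v = poly_eval p v + poly_eval q v"
proof -
  let ?S = "Poly_Mapping.keys p \<union> Poly_Mapping.keys q"
  have "Poly_Mapping.keys (p + q) \<subseteq> ?S" by (rule keys_add)
  then show ?thesis
    by (simp add: poly_eval_superset[of ?S] lookup_add algebra_simps sum.distrib)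
qed

lemma monom_eval_superset:
  assumes "finite S" "Poly_Mapping.keys m \<subseteq> S"
  shows "monom_eval m v = (\<Prod>i\<in>S. v i ^ Poly_Mapping.lookup m i)"
  unfolding monom_eval_def using assms
  by (intro prod.mono_neutral_left) (auto simp: in_keys_iff)

lemma monom_eval_add: "monom_eval (m + m') v = monom_eval m v * monom_eval m' v"
proof -
  let ?S = "Poly_Mapping.keys m \<union> Poly_Mapping.keys m'"
  have "Poly_Mapping.keys (m + m') \<subseteq> ?S" by (rule keys_add)
  then show ?thesis
    by (simp add: monom_eval_superset[of ?S] lookup_add power_add prod.distrib)
qed

lemma monom_deg_superset:
  assumes "finite S" "Poly_Mapping.keys m \<subseteq> S"
  shows "monom_deg m = (\<Sum>i\<in>S. Poly_Mapping.lookup m i)"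
  unfolding monom_deg_def using assms
  by (intro sum.mono_neutral_left) (auto simp: in_keys_iff)

lemma monom_deg_add: "monom_deg (m + m') = monom_deg m + monom_deg m'"
proof -
  let ?S = "Poly_Mapping.keys m \<union> Poly_Mapping.keys m'"
  have "Poly_Mapping.keys (m + m') \<subseteq> ?S" by (rule keys_add)
  then show ?thesis
    by (simp add: monom_deg_superset[of ?S] lookup_add sum.distrib)
qed

lemma poly_eval_0 [simp]: "poly_eval 0 v = 0"
  by (simp add: poly_eval_def)

lemma poly_eval_1 [simp]: "poly_eval 1 v = 1"
  by (simp add: poly_eval_def monom_eval_def lookup_one)

lemma poly_eval_single: "poly_eval (Poly_Mapping.single m c) v = c * monom_eval m v"
  by (simp add: poly_eval_def)

lemma update_conv_add:
  fixes f :: "'a \<Rightarrow>\<^sub>0 'b::monoid_add"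
  assumes "a \<notin> Poly_Mapping.keys f"
  shows "Poly_Mapping.update a b f = f + Poly_Mapping.single a b"
  using assms
  by (intro poly_mapping_eqI) (auto simp: lookup_update lookup_add lookup_single in_keys_iff when_def)

lemma poly_eval_mult: "poly_eval (p * q) v = poly_eval p v * poly_eval q v"
proof (induction p rule: Poly_Mapping.update_induct)
  case const
  then show ?case by simp
next
  case (update f a b)
  have "poly_eval (Poly_Mapping.single a b * q) v = b * monom_eval a v * poly_eval q v"
  proof (induction q rule: Poly_Mapping.update_induct)
    case const
    then show ?case by simp
  next
    case (update g m c)
    then show ?case
      by (simp add: update_conv_add distrib_left poly_eval_add mult_single poly_eval_single
          monom_eval_add)
  qed
  with update show ?case
    by (simp add: update_conv_add distrib_left distrib_right poly_eval_add poly_eval_single)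
qed

lemma homogeneous_1: "homogeneous I 0 1"
  by (auto simp: homogeneous_def monom_deg_def)

lemma homogeneous_mult:
  assumes "homogeneous I d p" "homogeneous I e q"
  shows "homogeneous I (d + e) (p * q)"
  unfolding homogeneous_def
proof
  fix m assume "m \<in> Poly_Mapping.keys (p * q)"
  then obtain a b where ab: "m = a + b" "a \<in> Poly_Mapping.keys p" "b \<in> Poly_Mapping.keys q"
    using keys_mult[of p q] by auto
  then show "Poly_Mapping.keys m \<subseteq> I \<and> monom_deg m = d + e"
    using assms keys_add[of a b] by (fastforce simp: homogeneous_def monom_deg_add)
qed

lemma homogeneous_scale:
  assumes "homogeneous I d p"
  shows "poly_eval p (\<lambda>i. c * v i) = c ^ d * poly_eval p v"
proof -
  have "monom_eval m (\<lambda>i. c * v i) = c ^ monom_deg m * monom_eval m v" for m :: "'a \<Rightarrow>\<^sub>0 nat"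
    by (simp add: monom_eval_def monom_deg_def power_mult_distrib prod.distrib power_sum)
  then show ?thesis
    using assms unfolding poly_eval_def homogeneous_def sum_distrib_left
    by (intro sum.cong) auto
qed

lemma proj_zero_iff:
  assumes "homogeneous I d p" "P \<in> proj_space I" "v \<in> P" "w \<in> P"
  shows "poly_eval p v = 0 \<longleftrightarrow> poly_eval p w = 0"
proof -
  obtain u a b where "a \<noteq> 0" "b \<noteq> 0" "v = (\<lambda>i. a * u i)" "w = (\<lambda>i. b * u i)"
    using assms unfolding proj_space_def proj_class_def by auto
  then show ?thesis by (simp add: homogeneous_scale[OF assms(1)])
qed

lemma istopology_zariski:
  "istopology (\<lambda>U. \<exists>F. (\<forall>p\<in>F. \<exists>d. homogeneous I d p) \<and> U = proj_space I - proj_zeros I F)"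
  (is "istopology ?L")
  unfolding istopology_def
proof (intro conjI allI impI)
  fix S T assume "?L S" "?L T"
  then obtain F G where F: "\<forall>p\<in>F. \<exists>d. homogeneous I d p" "S = proj_space I - proj_zeros I F"
    and G: "\<forall>p\<in>G. \<exists>d. homogeneous I d p" "T = proj_space I - proj_zeros I G" by blast
  let ?H = "{p * q | p q. p \<in> F \<and> q \<in> G}"
  have hom: "\<forall>p\<in>?H. \<exists>d. homogeneous I d p"
    using F(1) G(1) homogeneous_mult by blast
  have "proj_zeros I ?H = proj_zeros I F \<union> proj_zeros I G"
  proof
    show "proj_zeros I F \<union> proj_zeros I G \<subseteq> proj_zeros I ?H"
      by (auto simp: proj_zeros_def poly_eval_mult)
    show "proj_zeros I ?H \<subseteq> proj_zeros I F \<union> proj_zeros I G"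
    proof
      fix P assume P: "P \<in> proj_zeros I ?H"
      then have Pp: "P \<in> proj_space I" by (simp add: proj_zeros_def)
      show "P \<in> proj_zeros I F \<union> proj_zeros I G"
      proof (cases "P \<in> proj_zeros I F")
        case False
        then obtain p v where p: "p \<in> F" "v \<in> P" "poly_eval p v \<noteq> 0"
          using Pp by (auto simp: proj_zeros_def)
        have "poly_eval q w = 0" if "q \<in> G" "w \<in> P" for q w
        proof -
          have "poly_eval (p * q) v = 0"
            using P p that unfolding proj_zeros_def by blast
          then have "poly_eval q v = 0" using p by (simp add: poly_eval_mult)
          then show ?thesis using G(1) that p(2) Pp proj_zero_iff by metis
        qed
        then show ?thesis using Pp by (simp add: proj_zeros_def)
      qed simp
    qed
  qed
  then have "S \<inter> T = proj_space I - proj_zeros I ?H" using F(2) G(2) by blast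
  with hom show "?L (S \<inter> T)" by blast
next
  fix K assume "\<forall>S\<in>K. ?L S"
  then obtain F where F: "\<And>S. S \<in> K \<Longrightarrow> \<forall>p\<in>F S. \<exists>d. homogeneous I d p"
    "\<And>S. S \<in> K \<Longrightarrow> S = proj_space I - proj_zeros I (F S)" by metis
  have "proj_space I - proj_zeros I (\<Union>S\<in>K. F S) = (\<Union>S\<in>K. proj_space I - proj_zeros I (F S))"
    unfolding proj_zeros_def by blast
  also have "\<dots> = \<Union>K" using F(2) by blast
  finally have "\<Union>K = proj_space I - proj_zeros I (\<Union>S\<in>K. F S)" by simp
  moreover have "\<forall>p\<in>(\<Union>S\<in>K. F S). \<exists>d. homogeneous I d p" using F(1) by blast
  ultimately show "?L (\<Union>K)" by blast
qed

lemma openin_zariski: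
  "openin (zariski I) U \<longleftrightarrow>
     (\<exists>F. (\<forall>p\<in>F. \<exists>d. homogeneous I d p) \<and> U = proj_space I - proj_zeros I F)"
  unfolding zariski_def topology_inverse'[OF istopology_zariski] ..

lemma topspace_zariski: "topspace (zariski I) = proj_space I"
proof
  show "topspace (zariski I) \<subseteq> proj_space I"
    unfolding topspace_def openin_zariski by blast
  have "proj_zeros I {1} = {}"
    by (auto simp: proj_zeros_def proj_space_def proj_class_def)
  then have "openin (zariski I) (proj_space I)"
    unfolding openin_zariski using homogeneous_1 by (intro exI[of _ "{1}"]) auto
  then show "proj_space I \<subseteq> topspace (zariski I)" by (rule openin_subset)
qed

lemma closedin_zariski:
  "closedin (zariski I) Z \<longleftrightarrow> (\<exists>F. (\<forall>p\<in>F. \<exists>d. homogeneous I d p) \<and> Z = proj_zeros I F)"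
proof -
  have "proj_zeros I F \<subseteq> proj_space I" for F :: "'a cpoly set"
    by (auto simp: proj_zeros_def)
  then show ?thesis
    unfolding closedin_def topspace_zariski openin_zariski
    by (metis Diff_Diff_Int inf.absorb_iff2)
qed


section \<open>Dimension of a topological space\<close>

definition irreducible_in :: "'a topology \<Rightarrow> 'a set \<Rightarrow> bool" where
  "irreducible_in X S \<longleftrightarrow> S \<subseteq> topspace X \<and> S \<noteq> {} \<and>
     (\<forall>A B. closedin X A \<and> closedin X B \<and> S \<subseteq> A \<union> B \<longrightarrow> S \<subseteq> A \<or> S \<subseteq> B)"

text \<open>
  The supremum of the lengths \<open>d\<close> of chains \<open>Z\<^sub>0 \<subset> \<dots> \<subset> Z\<^sub>d\<close> of irreducible closed subsets.
  It is \<open>-\<infinity>\<close> for the empty space and \<open>\<infinity>\<close> if the lengths are unbounded.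
\<close>

definition krull_dim :: "'a topology \<Rightarrow> ereal" where
  "krull_dim X = Sup {ereal (real d) | d.
     \<exists>Z. (\<forall>i\<le>d. closedin X (Z i) \<and> irreducible_in X (Z i)) \<and> (\<forall>i<d. Z i \<subset> Z (Suc i))}"

definition proj_dim :: "'i set \<Rightarrow> ('i \<Rightarrow> complex) set set \<Rightarrow> ereal" where
  "proj_dim I V = krull_dim (subtopology (zariski I) V)"


section \<open>Tensor trains\<close>

definition tensor_indices :: "nat \<Rightarrow> (nat \<Rightarrow> nat) \<Rightarrow> (nat \<Rightarrow> nat) set" where
  "tensor_indices n k = (\<Pi>\<^sub>E i\<in>{0..n}. {1..k i})"

fun mat_chain :: "(nat \<Rightarrow> nat \<Rightarrow> complex mat) \<Rightarrow> (nat \<Rightarrow> nat) \<Rightarrow> nat \<Rightarrow> complex mat" where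
  "mat_chain A j 0 = A 0 (j 0)"
| "mat_chain A j (Suc i) = mat_chain A j i * A (Suc i) (j (Suc i))"

text \<open>With \<open>r 0 = r (n + 1) = 1\<close> the product of the matrices is \<open>1 \<times> 1\<close>, read as a number.\<close>

definition tt_tensor ::
  "nat \<Rightarrow> (nat \<Rightarrow> nat) \<Rightarrow> (nat \<Rightarrow> nat \<Rightarrow> complex mat) \<Rightarrow> (nat \<Rightarrow> nat) \<Rightarrow> complex" where
  "tt_tensor n k A = (\<lambda>j. if j \<in> tensor_indices n k then mat_chain A j n $$ (0, 0) else 0)"

definition tt_tensors :: "nat \<Rightarrow> (nat \<Rightarrow> nat) \<Rightarrow> (nat \<Rightarrow> nat) \<Rightarrow> ((nat \<Rightarrow> nat) \<Rightarrow> complex) set" where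
  "tt_tensors n k r = {tt_tensor n k A | A.
     \<forall>i\<in>{0..n}. \<forall>j\<in>{1..k i}. A i j \<in> carrier_mat (r i) (r (i + 1))}"

definition tt_variety ::
  "nat \<Rightarrow> (nat \<Rightarrow> nat) \<Rightarrow> (nat \<Rightarrow> nat) \<Rightarrow> ((nat \<Rightarrow> nat) \<Rightarrow> complex) set set" where
  "tt_variety n k r =
     zariski (tensor_indices n k) closure_of (proj_class ` (tt_tensors n k r - {\<lambda>_. 0}))"

end

(*
  Upper bound: the forms separating consecutive members of a chain of irreducible closed sets of
  length L are algebraically independent, so they yield (D + 1)^L linearly independent forms of
  degree proportional to D on the variety. By gauge fixing, the variety is the closure of the image
  of a map from an affine space of the claimed dimension N that is affine in each parameter; hence a
  form of degree K on it is determined by its values on a grid with (K + 1)^N points, and L <= N.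

  Lower bound: release the N gauge-fixed parameters one at a time, layer by layer from the left,
  starting at a base point at which the matrices to the right contain suitable unit vectors. Each
  parameter then is a coordinate of the tensor, relative to another coordinate that is constantly 1,
  so the closures of the images form a strictly increasing chain of irreducible sets.
*)
theory Submission
  imports Defs "Jordan_Normal_Form.Char_Poly"
begin

section \<open>Forms and the Zariski topology\<close>

text \<open>Forms are kept as functions rather than polynomials: all later arguments evaluate them
  at points or restrict them to curves. The zero function is a form of every degree.\<close>

definition form :: "'i set \<Rightarrow> nat \<Rightarrow> (('i \<Rightarrow> complex) \<Rightarrow> complex) \<Rightarrow> bool" where
  "form I d f \<longleftrightarrow> (\<exists>p. homogeneous I d p \<and> f = poly_eval p)"

lemma form_zero: "form I d (\<lambda>_. 0)"
  unfolding form_def by (intro exI[of _ 0]) (auto simp: homogeneous_def)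

lemma form_one: "form I 0 (\<lambda>_. 1)"
  unfolding form_def using homogeneous_1 by (intro exI[of _ 1]) auto

lemma form_add:
  assumes "form I d f" "form I d g"
  shows "form I d (\<lambda>v. f v + g v)"
proof -
  obtain p q where p: "homogeneous I d p" "f = poly_eval p" and q: "homogeneous I d q" "g = poly_eval q"
    using assms unfolding form_def by blast
  have "homogeneous I d (p + q)"
    using p(1) q(1) keys_add[of p q] unfolding homogeneous_def by blast
  then show ?thesis
    unfolding form_def using p q by (intro exI[of _ "p + q"]) (auto simp: poly_eval_add)
qed

lemma form_mult:
  assumes "form I d f" "form I e g"
  shows "form I (d + e) (\<lambda>v. f v * g v)"
proof -
  obtain p q where "homogeneous I d p" "f = poly_eval p" "homogeneous I e q" "g = poly_eval q"
    using assms unfolding form_def by blast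
  then show ?thesis
    unfolding form_def using homogeneous_mult
    by (intro exI[of _ "p * q"]) (auto simp: poly_eval_mult)
qed

lemma form_scale:
  assumes "form I d f"
  shows "form I d (\<lambda>v. c * f v)"
proof -
  have "homogeneous I 0 (Poly_Mapping.single 0 c)"
    by (auto simp: homogeneous_def monom_deg_def)
  then have "form I 0 (\<lambda>_. c)"
    unfolding form_def
    by (intro exI[of _ "Poly_Mapping.single 0 c"]) (auto simp: poly_eval_single monom_eval_def)
  from form_mult[OF this assms] show ?thesis by simp
qed

lemma form_power:
  assumes "form I d f"
  shows "form I (d * m) (\<lambda>v. f v ^ m)"
proof (induction m)
  case 0
  then show ?case using form_one by simp
next
  case (Suc m)
  from form_mult[OF assms Suc] show ?case by simp
qed

lemma form_sum:
  assumes "\<And>s. s \<in> S \<Longrightarrow> form I d (G s)"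
  shows "form I d (\<lambda>v. \<Sum>s\<in>S. c s * G s v)"
  using assms
proof (induction S rule: infinite_finite_induct)
  case (insert s S)
  then show ?case by (simp, intro form_add form_scale) auto
qed (auto intro: form_zero)

lemma form_coordinate:
  assumes "i \<in> I"
  shows "form I 1 (\<lambda>v. v i)"
proof -
  have "homogeneous I 1 (Poly_Mapping.single (Poly_Mapping.single i 1) 1)"
    using assms by (auto simp: homogeneous_def monom_deg_def)
  then show ?thesis
    unfolding form_def
    by (intro exI[of _ "Poly_Mapping.single (Poly_Mapping.single i 1) 1"])
      (auto simp: poly_eval_single monom_eval_def)
qed

lemma form_homogeneous:
  assumes "form I d f"
  shows "f (\<lambda>i. c * v i) = c ^ d * f v"
  using assms homogeneous_scale unfolding form_def by blast

lemma form_zero_on_class: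
  assumes "form I d f" "P \<in> proj_space I" "v \<in> P" "w \<in> P"
  shows "f v = 0 \<longleftrightarrow> f w = 0"
  using assms proj_zero_iff unfolding form_def by blast

lemma mem_proj_class: "v \<in> proj_class v"
  unfolding proj_class_def by (auto intro!: exI[of _ 1])

lemma form_zero_on_proj_class:
  assumes "form I d f" "f v = 0" "w \<in> proj_class v"
  shows "f w = 0"
  using assms form_homogeneous[OF assms(1)] unfolding proj_class_def by auto

lemma closedin_form_zeros:
  assumes "form I d f"
  shows "closedin (zariski I) {P \<in> proj_space I. \<forall>v\<in>P. f v = 0}"
proof -
  obtain p where "homogeneous I d p" "f = poly_eval p"
    using assms unfolding form_def by blast
  then show ?thesis
    unfolding closedin_zariski by (intro exI[of _ "{p}"]) (auto simp: proj_zeros_def)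
qed

text \<open>Some form defining \<open>Z\<close> is nonzero at one representative of
  \<open>P\<close>; homogeneity carries this to the whole class.\<close>

lemma closedin_zariski_separate:
  assumes "closedin (zariski I) Z" "P \<in> proj_space I" "P \<notin> Z"
  obtains d f where "form I d f" "\<And>v. v \<in> \<Union>Z \<Longrightarrow> f v = 0" "\<And>v. v \<in> P \<Longrightarrow> f v \<noteq> 0"
proof -
  obtain F where F: "\<forall>p\<in>F. \<exists>d. homogeneous I d p" "Z = proj_zeros I F"
    using assms(1) unfolding closedin_zariski by blast
  obtain p w where p: "p \<in> F" "w \<in> P" "poly_eval p w \<noteq> 0"
    using assms(2,3) F(2) unfolding proj_zeros_def by blast
  obtain d where d: "homogeneous I d p" using F(1) p(1) by blast
  then have form: "form I d (poly_eval p)" unfolding form_def by blast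
  show ?thesis
  proof (rule that[OF form])
    show "poly_eval p v = 0" if "v \<in> \<Union>Z" for v
      using that F(2) p(1) unfolding proj_zeros_def by blast
    show "poly_eval p v \<noteq> 0" if "v \<in> P" for v
      using form_zero_on_class[OF form assms(2) that p(2)] p(3) by blast
  qed
qed

section \<open>Closures of cones and primality of their vanishing ideals\<close>

definition proj_closure :: "'i set \<Rightarrow> ('i \<Rightarrow> complex) set \<Rightarrow> ('i \<Rightarrow> complex) set set" where
  "proj_closure I T = zariski I closure_of (proj_class ` T)"

lemma closedin_proj_closure: "closedin (zariski I) (proj_closure I T)"
  unfolding proj_closure_def by simp

lemma proj_class_in_closure:
  assumes "T \<subseteq> coord_space I - {\<lambda>_. 0}" "v \<in> T"
  shows "proj_class v \<in> proj_closure I T"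
proof -
  have "proj_class ` T \<subseteq> topspace (zariski I)"
    using assms(1) unfolding topspace_zariski proj_space_def by blast
  from closure_of_subset[OF this] show ?thesis
    unfolding proj_closure_def using assms(2) by blast
qed

lemma proj_closure_minimal:
  assumes "closedin (zariski I) Z" "\<And>v. v \<in> T \<Longrightarrow> proj_class v \<in> Z"
  shows "proj_closure I T \<subseteq> Z"
  unfolding proj_closure_def by (rule closure_of_minimal) (use assms in auto)

text \<open>The zero locus of a form is closed, so it contains the closure once it contains the
  classes of \<open>T\<close>.\<close>

lemma form_zero_on_closure:
  assumes "T \<subseteq> coord_space I - {\<lambda>_. 0}" "form I d f" "\<And>v. v \<in> T \<Longrightarrow> f v = 0"
    "w \<in> \<Union>(proj_closure I T)"
  shows "f w = 0"
proof -
  have "proj_closure I T \<subseteq> {P \<in> proj_space I. \<forall>v\<in>P. f v = 0}"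
  proof (rule proj_closure_minimal[OF closedin_form_zeros[OF assms(2)]])
    fix v assume "v \<in> T"
    then show "proj_class v \<in> {P \<in> proj_space I. \<forall>v\<in>P. f v = 0}"
      using assms(1,3) form_zero_on_proj_class[OF assms(2)] unfolding proj_space_def by blast
  qed
  then show ?thesis using assms(4) by blast
qed

text \<open>The homogeneous vanishing ideal of \<open>C\<close> is prime.\<close>

definition prime_cone :: "'i set \<Rightarrow> ('i \<Rightarrow> complex) set \<Rightarrow> bool" where
  "prime_cone I C \<longleftrightarrow> C \<noteq> {} \<and> (\<forall>d e f g. form I d f \<longrightarrow> form I e g \<longrightarrow> (\<forall>v\<in>C. f v * g v = 0) \<longrightarrow>
     (\<forall>v\<in>C. f v = 0) \<or> (\<forall>v\<in>C. g v = 0))"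

lemma prime_coneD:
  assumes "prime_cone I C" "form I d f" "form I e g" "\<And>v. v \<in> C \<Longrightarrow> f v * g v = 0"
    "w \<in> C" "f w \<noteq> 0" "v \<in> C"
  shows "g v = 0"
  using assms unfolding prime_cone_def by meson

text \<open>If \<open>f * g\<close> vanishes on the cone, the zero loci of \<open>f\<close> and
  \<open>g\<close> are two closed sets covering \<open>Z\<close>, and irreducibility picks one of
  them.\<close>

lemma irreducible_imp_prime_cone:
  assumes "irreducible_in (subtopology (zariski I) V) Z"
  shows "prime_cone I (\<Union>Z)"
proof -
  have Z: "Z \<subseteq> proj_space I" "Z \<subseteq> V" "Z \<noteq> {}"
    using assms unfolding irreducible_in_def topspace_subtopology topspace_zariski by auto
  obtain P where "P \<in> Z" using Z by blast
  moreover then have "P \<noteq> {}"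
    using Z(1) mem_proj_class unfolding proj_space_def by blast
  ultimately have "\<Union>Z \<noteq> {}" by blast
  moreover
  { fix d e f g assume f: "form I d f" and g: "form I e g" and fg: "\<forall>v\<in>\<Union>Z. f v * g v = 0"
    define A where "A = {P \<in> proj_space I. \<forall>v\<in>P. f v = 0} \<inter> V"
    define B where "B = {P \<in> proj_space I. \<forall>v\<in>P. g v = 0} \<inter> V"
    have "closedin (subtopology (zariski I) V) A" "closedin (subtopology (zariski I) V) B"
      unfolding A_def B_def closedin_subtopology
      using closedin_form_zeros[OF f] closedin_form_zeros[OF g] by blast+
    moreover have "Z \<subseteq> A \<union> B"
    proof
      fix P assume P: "P \<in> Z"
      then have PI: "P \<in> proj_space I" "P \<in> V" using Z by auto
      obtain v where v: "v \<in> P"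
        using PI mem_proj_class unfolding proj_space_def by blast
      then have "f v = 0 \<or> g v = 0" using fg P by auto
      then show "P \<in> A \<union> B"
        unfolding A_def B_def
        using PI form_zero_on_class[OF f PI(1) v] form_zero_on_class[OF g PI(1) v] by blast
    qed
    ultimately have "Z \<subseteq> A \<or> Z \<subseteq> B" using assms unfolding irreducible_in_def by blast
    then have "(\<forall>v\<in>\<Union>Z. f v = 0) \<or> (\<forall>v\<in>\<Union>Z. g v = 0)"
      unfolding A_def B_def by blast }
  ultimately show ?thesis unfolding prime_cone_def by blast
qed

text \<open>If the closure lay in neither closed set, points of \<open>T\<close> outside each of
  them would give separating forms whose product vanishes on \<open>T\<close>, against primality. By
  density only points of \<open>T\<close> have to be tested.\<close>

lemma prime_cone_imp_irreducible:
  assumes T: "T \<subseteq> coord_space I - {\<lambda>_. 0}" "prime_cone I T" and V: "proj_closure I T \<subseteq> V"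
  shows "irreducible_in (subtopology (zariski I) V) (proj_closure I T)"
  unfolding irreducible_in_def
proof (intro conjI allI impI)
  show "proj_closure I T \<subseteq> topspace (subtopology (zariski I) V)"
    using V closedin_subset[OF closedin_proj_closure] unfolding topspace_subtopology by blast
  show "proj_closure I T \<noteq> {}"
    using T proj_class_in_closure unfolding prime_cone_def by blast
next
  fix A B
  assume AB: "closedin (subtopology (zariski I) V) A \<and> closedin (subtopology (zariski I) V) B \<and>
    proj_closure I T \<subseteq> A \<union> B"
  then obtain A' B' where A': "closedin (zariski I) A'" "A = A' \<inter> V"
    and B': "closedin (zariski I) B'" "B = B' \<inter> V"
    unfolding closedin_subtopology by blast
  have proj: "proj_class v \<in> proj_space I" if "v \<in> T" for v
    using that T(1) unfolding proj_space_def by blast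
  show "proj_closure I T \<subseteq> A \<or> proj_closure I T \<subseteq> B"
  proof (rule ccontr)
    assume "\<not> ?thesis"
    then obtain v w where v: "v \<in> T" "proj_class v \<notin> A'" and w: "w \<in> T" "proj_class w \<notin> B'"
      using proj_closure_minimal[OF A'(1)] proj_closure_minimal[OF B'(1)] A'(2) B'(2) V
      by (metis Int_subset_iff)
    obtain d f where f: "form I d f" "\<And>u. u \<in> \<Union>A' \<Longrightarrow> f u = 0" "f v \<noteq> 0"
      using closedin_zariski_separate[OF A'(1) proj[OF v(1)] v(2)] mem_proj_class by metis
    obtain e g where g: "form I e g" "\<And>u. u \<in> \<Union>B' \<Longrightarrow> g u = 0" "g w \<noteq> 0"
      using closedin_zariski_separate[OF B'(1) proj[OF w(1)] w(2)] mem_proj_class by metis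
    have "f u * g u = 0" if "u \<in> T" for u
    proof -
      have "proj_class u \<in> A' \<or> proj_class u \<in> B'"
        using proj_class_in_closure[OF T(1) that] AB A'(2) B'(2) by blast
      then show ?thesis using f(2) g(2) mem_proj_class by fastforce
    qed
    then show False using prime_coneD[OF T(2) f(1) g(1)] v(1) w(1) f(3) g(3) by blast
  qed
qed

section \<open>Independent forms and chains of prime cones\<close>

text \<open>In other words, the Hilbert function of the vanishing ideal of \<open>C\<close> is at
  least \<open>m\<close> in degree \<open>K\<close>.\<close>

definition indep_forms :: "'i set \<Rightarrow> nat \<Rightarrow> ('i \<Rightarrow> complex) set \<Rightarrow> nat \<Rightarrow> bool" where
  "indep_forms I K C m \<longleftrightarrow> (\<exists>G. (\<forall>s<m. form I K (G s)) \<and>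
     (\<forall>c. (\<forall>v\<in>C. (\<Sum>s<m. c s * G s v) = 0) \<longrightarrow> (\<forall>s<m. c s = 0)))"

lemma indep_forms_mono:
  assumes "indep_forms I K C m" "C \<subseteq> C'"
  shows "indep_forms I K C' m"
proof -
  obtain G where G: "\<forall>s<m. form I K (G s)"
    "\<And>c. (\<forall>v\<in>C. (\<Sum>s<m. c s * G s v) = 0) \<Longrightarrow> \<forall>s<m. c s = 0"
    using assms(1) unfolding indep_forms_def by blast
  show ?thesis
    unfolding indep_forms_def
  proof (intro exI[of _ G] conjI allI impI G(1)[rule_format])
    fix c s assume c: "\<forall>v\<in>C'. (\<Sum>s<m. c s * G s v) = 0" "s < m"
    have "\<forall>v\<in>C. (\<Sum>s<m. c s * G s v) = 0" using c(1) assms(2) by blast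
    from G(2)[OF this] c(2) show "c s = 0" by blast
  qed
qed

lemma sum_split_lessThan: "(\<Sum>s<a + b. h s) = (\<Sum>s<a. h s) + (\<Sum>s<b. h (a + s))"
  for h :: "nat \<Rightarrow> 'a::comm_monoid_add"
  by (induction b) (auto simp: add_ac)

text \<open>The new family consists of the forms independent on \<open>C\<close> and the multiples
  by \<open>f\<close> of those independent on \<open>C'\<close>. Restricting a relation to
  \<open>C\<close> kills the multiples of \<open>f\<close> and hence the first coefficients;
  primality then cancels \<open>f\<close> from what remains.\<close>

lemma indep_forms_add:
  assumes C: "C \<subseteq> C'" "prime_cone I C'"
    and f: "form I e f" "\<And>v. v \<in> C \<Longrightarrow> f v = 0" "w \<in> C'" "f w \<noteq> 0"
    and a: "indep_forms I (K + e) C a" and b: "indep_forms I K C' b"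
  shows "indep_forms I (K + e) C' (a + b)"
proof -
  obtain G where G: "\<And>s. s < a \<Longrightarrow> form I (K + e) (G s)"
    "\<And>c. (\<forall>v\<in>C. (\<Sum>s<a. c s * G s v) = 0) \<Longrightarrow> \<forall>s<a. c s = 0"
    using a unfolding indep_forms_def by blast
  obtain H where H: "\<And>s. s < b \<Longrightarrow> form I K (H s)"
    "\<And>c. (\<forall>v\<in>C'. (\<Sum>s<b. c s * H s v) = 0) \<Longrightarrow> \<forall>s<b. c s = 0"
    using b unfolding indep_forms_def by blast
  define E where "E = (\<lambda>s v. if s < a then G s v else H (s - a) v * f v)"
  have E: "form I (K + e) (E s)" if "s < a + b" for s
    using that G(1) form_mult[OF H(1) f(1)] unfolding E_def by (cases "s < a") auto
  have sum: "(\<Sum>s<a + b. c s * E s v) = (\<Sum>s<a. c s * G s v) + f v * (\<Sum>s<b. c (a + s) * H s v)"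
    for c v
    unfolding sum_split_lessThan E_def by (simp add: sum_distrib_left mult_ac)
  have "\<forall>s<a + b. c s = 0" if c: "\<forall>v\<in>C'. (\<Sum>s<a + b. c s * E s v) = 0" for c
  proof -
    have c1: "\<forall>s<a. c s = 0"
      using c C(1) f(2) unfolding sum by (intro G(2)) fastforce
    then have "f v * (\<Sum>s<b. c (a + s) * H s v) = 0" if "v \<in> C'" for v
      using c that unfolding sum by simp
    moreover have "form I K (\<lambda>v. \<Sum>s<b. c (a + s) * H s v)"
      by (rule form_sum) (simp add: H(1))
    ultimately have "\<forall>v\<in>C'. (\<Sum>s<b. c (a + s) * H s v) = 0"
      using prime_coneD[OF C(2) f(1) _ _ f(3,4)] by blast
    from H(2)[OF this] have "\<forall>s<b. c (a + s) = 0" .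
    with c1 show ?thesis by (metis add_diff_inverse_nat nat_add_left_cancel_less)
  qed
  with E show ?thesis unfolding indep_forms_def by blast
qed

text \<open>Iterating \<open>indep_forms_add\<close> attaches the powers of \<open>f\<close> from
  \<open>0\<close> to \<open>D\<close> to families independent on \<open>C\<close>. The hypothesis
  covers all large degrees because each power of \<open>f\<close> leaves a different degree to be
  filled.\<close>

lemma indep_forms_step:
  assumes C: "C \<subseteq> C'" "prime_cone I C'"
    and f: "form I e f" "\<And>v. v \<in> C \<Longrightarrow> f v = 0" "w \<in> C'" "f w \<noteq> 0"
    and a: "\<And>K. K \<ge> K0 \<Longrightarrow> indep_forms I K C a"
  shows "K \<ge> K0 + D * e \<Longrightarrow> indep_forms I K C' (Suc D * a)"
proof (induction D arbitrary: K)
  case 0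
  then show ?case using indep_forms_mono[OF a C(1)] by simp
next
  case (Suc D)
  then have K: "K - e + e = K" "K - e + e \<ge> K0" "K - e \<ge> K0 + D * e" by auto
  show ?case using indep_forms_add[OF C f a[OF K(2)] Suc.IH[OF K(3)]] K(1) by simp
qed

lemma indep_forms_chain:
  fixes C :: "nat \<Rightarrow> ('i \<Rightarrow> complex) set"
  assumes "\<And>i. i \<le> L \<Longrightarrow> prime_cone I (C i)" "\<And>i. i < L \<Longrightarrow> C i \<subseteq> C (Suc i)"
    and x: "form I 1 x" "u \<in> C 0" "x u \<noteq> 0"
    and f: "\<And>i. i < L \<Longrightarrow> form I (e i) (f i)" "\<And>i v. i < L \<Longrightarrow> v \<in> C i \<Longrightarrow> f i v = 0"
      "\<And>i. i < L \<Longrightarrow> w i \<in> C (Suc i)" "\<And>i. i < L \<Longrightarrow> f i (w i) \<noteq> 0"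
  shows "l \<le> L \<Longrightarrow> K \<ge> D * (\<Sum>i<l. e i) \<Longrightarrow> indep_forms I K (C l) (Suc D ^ l)"
proof (induction l arbitrary: K)
  case 0
  \<comment> \<open>A coordinate that is nonzero at a point of \<open>C 0\<close> supplies one
    independent form in every degree.\<close>
  have "form I K (\<lambda>v. x v ^ K)" using form_power[OF x(1), of K] by simp
  then show ?case
    unfolding indep_forms_def using x(2,3) by (intro exI[of _ "\<lambda>_ v. x v ^ K"]) auto
next
  case (Suc l)
  then have l: "l < L" by simp
  from Suc.prems have K: "K \<ge> D * (\<Sum>i<l. e i) + D * e l" by (simp add: algebra_simps)
  show ?case
    using indep_forms_step[OF assms(2)[OF l] assms(1)[OF Suc.prems(1)] f(1)[OF l] f(2)[OF l]
        f(3)[OF l] f(4)[OF l] Suc.IH[OF less_imp_le[OF l]] K] by simp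
qed

section \<open>Dimension bounds from independent forms and from flags\<close>

lemma exists_coordinate:
  assumes "P \<in> proj_space I" "v \<in> P"
  obtains i where "i \<in> I" "v i \<noteq> 0"
  using assms unfolding proj_space_def proj_class_def coord_space_def by fastforce

text \<open>A chain of length \<open>L\<close> yields \<open>Suc D ^ L\<close> independent forms in
  degree \<open>D * E\<close> with \<open>E\<close> fixed. Growth of order \<open>N\<close> in the
  degree then forces \<open>L \<le> N\<close> as \<open>D\<close> grows.\<close>

lemma proj_dim_le:
  assumes V: "closedin (zariski I) V"
    and bound: "\<And>K m. indep_forms I K (\<Union>V) m \<Longrightarrow> m \<le> Suc K ^ N"
  shows "proj_dim I V \<le> ereal (real N)"
  unfolding proj_dim_def krull_dim_def
proof (rule Sup_least, clarify)
  fix L :: nat and Z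
  assume Z: "\<forall>i\<le>L. closedin (subtopology (zariski I) V) (Z i) \<and>
      irreducible_in (subtopology (zariski I) V) (Z i)"
    and chain: "\<forall>i<L. Z i \<subset> Z (Suc i)"
  have closed: "closedin (zariski I) (Z i)" "Z i \<subseteq> V" if "i \<le> L" for i
    using Z that closedin_closed_subtopology[OF V] by auto
  then have proj: "Z i \<subseteq> proj_space I" if "i \<le> L" for i
    using that closedin_subset topspace_zariski by metis
  have prime: "prime_cone I (\<Union>(Z i))" if "i \<le> L" for i
    using Z that irreducible_imp_prime_cone by blast
  obtain u P where u: "u \<in> P" "P \<in> Z 0" using prime[of 0] unfolding prime_cone_def by auto
  then obtain q where q: "q \<in> I" "u q \<noteq> 0" using proj[of 0] exists_coordinate by blast
  have "\<exists>e f w. form I e f \<and> (\<forall>v\<in>\<Union>(Z i). f v = 0) \<and> w \<in> \<Union>(Z (Suc i)) \<and> f w \<noteq> 0"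
    if i: "i < L" for i
  proof -
    obtain P where P: "P \<in> Z (Suc i)" "P \<notin> Z i" using chain i by blast
    then have PI: "P \<in> proj_space I" using proj[of "Suc i"] i by auto
    obtain e f where f: "form I e f" "\<And>v. v \<in> \<Union>(Z i) \<Longrightarrow> f v = 0" "\<And>v. v \<in> P \<Longrightarrow> f v \<noteq> 0"
      using closedin_zariski_separate[OF closed(1) PI P(2)] i by auto
    obtain w where "w \<in> P" using PI mem_proj_class unfolding proj_space_def by blast
    then show ?thesis using f P(1) by blast
  qed
  then obtain e f w where f: "\<And>i. i < L \<Longrightarrow> form I (e i) (f i)"
    "\<And>i v. i < L \<Longrightarrow> v \<in> \<Union>(Z i) \<Longrightarrow> f i v = 0"
    "\<And>i. i < L \<Longrightarrow> w i \<in> \<Union>(Z (Suc i))" "\<And>i. i < L \<Longrightarrow> f i (w i) \<noteq> 0"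
    by metis
  define E where "E = (\<Sum>i<L. e i)"
  have indep: "indep_forms I (D * E) (\<Union>(Z L)) (Suc D ^ L)" for D
    unfolding E_def
    by (rule indep_forms_chain[where L = L and C = "\<lambda>i. \<Union>(Z i)" and x = "\<lambda>v. v q" and u = u
          and f = f and w = w])
      (use prime chain form_coordinate[OF q(1)] u q f in auto)
  have ineq: "Suc D ^ L \<le> Suc (D * E) ^ N" for D
    using bound[OF indep_forms_mono[OF indep]] closed(2)[of L] by auto
  have "L \<le> N"
  proof (rule ccontr)
    assume "\<not> L \<le> N"
    \<comment> \<open>Taking \<open>D = c\<close> suffices: \<open>c * E + 1\<close> is at most
      \<open>Suc E * Suc c\<close>, so the bound becomes \<open>c * Suc c ^ N\<close>, while
      \<open>L > N\<close> would require at least \<open>Suc c * Suc c ^ N\<close>.\<close>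
    define c where "c = Suc E ^ N"
    have "Suc c * Suc c ^ N \<le> Suc c ^ L"
      using \<open>\<not> L \<le> N\<close> power_increasing[of "Suc N" L "Suc c"] by simp
    also have "\<dots> \<le> Suc (c * E) ^ N" by (rule ineq)
    also have "\<dots> \<le> (Suc E * Suc c) ^ N" by (rule power_mono) auto
    also have "\<dots> = c * Suc c ^ N" by (simp only: power_mult_distrib c_def)
    finally have "Suc c * Suc c ^ N \<le> c * Suc c ^ N" .
    then show False using mult_le_cancel2 by simp
  qed
  then show "ereal (real L) \<le> ereal (real N)" by simp
qed

text \<open>The closures of the \<open>T s\<close> form the chain. Inclusions are strict because
  \<open>f s\<close> vanishes on \<open>T s\<close>, hence on its closure, but not on all of
  \<open>T (Suc s)\<close>.\<close>

lemma proj_dim_ge: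
  assumes V: "closedin (zariski I) V"
    and T: "\<And>s. s \<le> N \<Longrightarrow> T s \<subseteq> coord_space I - {\<lambda>_. 0}" "\<And>s. s \<le> N \<Longrightarrow> prime_cone I (T s)"
      "\<And>s v. s \<le> N \<Longrightarrow> v \<in> T s \<Longrightarrow> proj_class v \<in> V" "\<And>s. s < N \<Longrightarrow> T s \<subseteq> T (Suc s)"
    and f: "\<And>s. s < N \<Longrightarrow> form I (d s) (f s)" "\<And>s v. s < N \<Longrightarrow> v \<in> T s \<Longrightarrow> f s v = 0"
      "\<And>s. s < N \<Longrightarrow> \<exists>v\<in>T (Suc s). f s v \<noteq> 0"
  shows "ereal (real N) \<le> proj_dim I V"
  unfolding proj_dim_def krull_dim_def
proof (rule Sup_upper, rule CollectI,
    rule exI[of _ N], rule conjI[OF refl], rule exI[of _ "\<lambda>s. proj_closure I (T s)"],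
    intro conjI allI impI)
  fix s assume s: "s \<le> N"
  have sub: "proj_closure I (T s) \<subseteq> V"
    by (rule proj_closure_minimal[OF V T(3)[OF s]])
  then show "closedin (subtopology (zariski I) V) (proj_closure I (T s))"
    using closedin_proj_closure closedin_closed_subtopology[OF V] by blast
  show "irreducible_in (subtopology (zariski I) V) (proj_closure I (T s))"
    by (rule prime_cone_imp_irreducible[OF T(1)[OF s] T(2)[OF s] sub])
next
  fix s assume s: "s < N"
  obtain v where v: "v \<in> T (Suc s)" "f s v \<noteq> 0" using f(3)[OF s] by blast
  have "proj_class v \<in> proj_closure I (T (Suc s))"
    using proj_class_in_closure[OF T(1) v(1)] s by simp
  moreover have "proj_class v \<notin> proj_closure I (T s)"
  proof
    assume "proj_class v \<in> proj_closure I (T s)"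
    then have "v \<in> \<Union>(proj_closure I (T s))" using mem_proj_class by blast
    from form_zero_on_closure[OF T(1) f(1) f(2) this] show False using v(2) s by simp
  qed
  moreover have "proj_closure I (T s) \<subseteq> proj_closure I (T (Suc s))"
    using T(4)[OF s] unfolding proj_closure_def by (intro closure_of_mono) auto
  ultimately show "proj_closure I (T s) \<subset> proj_closure I (T (Suc s))" by blast
qed

section \<open>Polynomial dependence on parameters\<close>

text \<open>One variable is enough: dependence on several parameters is always tested along a line
  or in one parameter at a time.\<close>

definition poly_fun :: "nat \<Rightarrow> (complex \<Rightarrow> complex) \<Rightarrow> bool" where
  "poly_fun d f \<longleftrightarrow> (\<exists>p. degree p \<le> d \<and> f = poly p)"

lemma poly_fun_const: "poly_fun d (\<lambda>_. c)"
  unfolding poly_fun_def by (intro exI[of _ "[:c:]"]) auto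

lemma poly_fun_linear: "poly_fun (Suc d) (\<lambda>t. c + t * b)"
  unfolding poly_fun_def by (intro exI[of _ "[:c, b:]"]) auto

lemma poly_fun_mono: "poly_fun d f \<Longrightarrow> d \<le> e \<Longrightarrow> poly_fun e f"
  unfolding poly_fun_def using order_trans by blast

lemma poly_fun_add:
  assumes "poly_fun d f" "poly_fun d g"
  shows "poly_fun d (\<lambda>t. f t + g t)"
proof -
  obtain p q where "degree p \<le> d" "f = poly p" "degree q \<le> d" "g = poly q"
    using assms unfolding poly_fun_def by blast
  then show ?thesis
    unfolding poly_fun_def by (intro exI[of _ "p + q"]) (auto intro: degree_add_le)
qed

lemma poly_fun_mult:
  assumes "poly_fun d f" "poly_fun e g"
  shows "poly_fun (d + e) (\<lambda>t. f t * g t)"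
proof -
  obtain p q where "degree p \<le> d" "f = poly p" "degree q \<le> e" "g = poly q"
    using assms unfolding poly_fun_def by blast
  then show ?thesis
    unfolding poly_fun_def using degree_mult_le[of p q] by (intro exI[of _ "p * q"]) auto
qed

lemma poly_fun_power: "poly_fun d f \<Longrightarrow> poly_fun (d * m) (\<lambda>t. f t ^ m)"
  by (induction m) (auto intro: poly_fun_const poly_fun_mult)

lemma poly_fun_sum:
  assumes "\<And>s. s \<in> S \<Longrightarrow> poly_fun d (f s)"
  shows "poly_fun d (\<lambda>t. \<Sum>s\<in>S. f s t)"
  using assms by (induction S rule: infinite_finite_induct) (auto intro: poly_fun_const poly_fun_add)

lemma poly_fun_prod:
  assumes "\<And>s. s \<in> S \<Longrightarrow> poly_fun (d s) (f s)"
  shows "poly_fun (\<Sum>s\<in>S. d s) (\<lambda>t. \<Prod>s\<in>S. f s t)"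
  using assms by (induction S rule: infinite_finite_induct) (auto intro: poly_fun_const poly_fun_mult)

text \<open>Every monomial of the form is a product of \<open>K\<close> coordinates, counted with
  multiplicity, each contributing degree at most \<open>m\<close>.\<close>

lemma poly_fun_form:
  assumes "form I K f" "\<And>i. poly_fun m (\<lambda>t. v t i)"
  shows "poly_fun (m * K) (\<lambda>t. f (v t))"
proof -
  obtain p where p: "homogeneous I K p" "f = poly_eval p" using assms(1) unfolding form_def by blast
  have "poly_fun (m * K) (\<lambda>t. Poly_Mapping.lookup p \<mu> * monom_eval \<mu> (v t))"
    if "\<mu> \<in> Poly_Mapping.keys p" for \<mu>
  proof -
    have "poly_fun (\<Sum>i\<in>Poly_Mapping.keys \<mu>. m * Poly_Mapping.lookup \<mu> i) (\<lambda>t. monom_eval \<mu> (v t))"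
      unfolding monom_eval_def by (intro poly_fun_prod poly_fun_power assms(2))
    also have "(\<Sum>i\<in>Poly_Mapping.keys \<mu>. m * Poly_Mapping.lookup \<mu> i) = m * K"
      using p(1) that unfolding homogeneous_def monom_deg_def by (auto simp flip: sum_distrib_left)
    finally show ?thesis using poly_fun_mult[OF poly_fun_const[of 0]] by fastforce
  qed
  then show ?thesis unfolding p(2) poly_eval_def by (intro poly_fun_sum)
qed

section \<open>Vanishing criteria for polynomials and linear systems\<close>

lemma poly_fun_zero:
  assumes "poly_fun d f" "d < card X" "\<And>t. t \<in> X \<Longrightarrow> f t = 0"
  shows "f t = 0"
proof -
  obtain p where p: "degree p \<le> d" "f = poly p" using assms(1) unfolding poly_fun_def by blast
  have "p = 0"
  proof (rule ccontr)
    assume "p \<noteq> 0"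
    then have "card {t. poly p t = 0} \<le> d"
      using poly_roots_degree[of p] p(1) by simp
    moreover have "card X \<le> card {t. poly p t = 0}"
      using assms(3) p(2) poly_roots_finite[OF \<open>p \<noteq> 0\<close>] by (intro card_mono) auto
    ultimately show False using assms(2) by simp
  qed
  then show ?thesis using p(2) by simp
qed

lemma poly_fun_zero_cofinite:
  assumes "poly_fun d f" "finite X" "\<And>t. t \<notin> X \<Longrightarrow> f t = 0"
  shows "f t = 0"
proof -
  obtain p where p: "f = poly p" using assms(1) unfolding poly_fun_def by blast
  have "p = 0"
  proof (rule ccontr)
    assume "p \<noteq> 0"
    then have "finite ({t. poly p t = 0} \<union> X)" using poly_roots_finite assms(2) by auto
    moreover have "{t. poly p t = 0} \<union> X = UNIV" using assms(3) p by auto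
    ultimately show False using infinite_UNIV_char_0 by metis
  qed
  then show ?thesis using p by simp
qed

lemma poly_fun_mult_zero:
  assumes "poly_fun d f" "poly_fun e g" "\<And>t. f t * g t = 0" "f s \<noteq> 0"
  shows "g t = 0"
proof -
  obtain p q where p: "f = poly p" "g = poly q" using assms(1,2) unfolding poly_fun_def by blast
  have "poly (p * q) = poly 0" using assms(3) p by auto
  then have "p * q = 0" by (metis poly_eq_poly_eq_iff)
  then show ?thesis using p assms(4) by auto
qed

text \<open>The coordinates in \<open>R\<close> are released from the grid one at a time, each by
  counting the roots of a univariate polynomial. The bound \<open>K\<close> is on the degree in each
  variable separately, not on the total degree.\<close>

lemma zero_on_grid:
  fixes f :: "('q \<Rightarrow> complex) \<Rightarrow> complex"
  assumes "finite Q" and poly: "\<And>q y. q \<in> Q \<Longrightarrow> poly_fun K (\<lambda>t. f (y(q := t)))" and X: "K < card X"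
    and "\<And>y. (\<And>q. q \<in> Q \<Longrightarrow> y q \<in> X) \<Longrightarrow> (\<And>q. q \<notin> Q \<Longrightarrow> y q = y0 q) \<Longrightarrow> f y = 0"
    and "\<And>q. q \<notin> Q \<Longrightarrow> y q = y0 q"
  shows "f y = 0"
proof -
  have "f y = 0" if "\<And>q. q \<notin> Q \<Longrightarrow> y q = y0 q" "\<And>q. q \<in> Q - R \<Longrightarrow> y q \<in> X" "R \<subseteq> Q" for R y
  proof -
    have "finite R" using that(3) assms(1) finite_subset by blast
    then show ?thesis using that
    proof (induction R arbitrary: y)
      case empty
      then show ?case using assms(4)[of y] by auto
    next
      case (insert q R)
      have "f (y(q := t)) = 0" if "t \<in> X" for t
        using insert.prems insert.hyps that by (intro insert.IH) auto
      then have "f (y(q := y q)) = 0"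
        using insert.prems(3) by (intro poly_fun_zero[OF poly[of q y] X, of "y q"]) auto
      then show ?case by simp
    qed
  qed
  from this[of y Q] assms(5) show ?thesis by auto
qed

text \<open>Gaussian elimination on a homogeneous system with the elements of \<open>S\<close> as
  unknowns and those of \<open>B\<close> as equations.\<close>

lemma nontrivial_solution:
  fixes a :: "'s \<Rightarrow> 'b \<Rightarrow> 'c::field"
  assumes "finite B" "finite S" "card B < card S"
  shows "\<exists>c. (\<exists>s\<in>S. c s \<noteq> 0) \<and> (\<forall>\<beta>\<in>B. (\<Sum>s\<in>S. c s * a s \<beta>) = 0)"
  using assms
proof (induction B arbitrary: S a rule: finite_induct)
  case empty
  then obtain s where "s \<in> S" by fastforce
  then show ?case by (intro exI[of _ "\<lambda>_. 1"]) auto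
next
  case (insert \<beta>0 B)
  show ?case
  proof (cases "\<forall>s\<in>S. a s \<beta>0 = 0")
    case True
    have "card B < card S" using insert by simp
    from insert.IH[OF insert.prems(1) this] True show ?thesis by fastforce
  next
    case False
    then obtain s0 where s0: "s0 \<in> S" "a s0 \<beta>0 \<noteq> 0" by blast
    \<comment> \<open>The unknown \<open>s0\<close> is eliminated by means of equation
      \<open>\<beta>0\<close>; below, \<open>c0\<close> is the value that this equation then forces
      for it.\<close>
    define a' where "a' = (\<lambda>s \<beta>. a s \<beta> - a s \<beta>0 / a s0 \<beta>0 * a s0 \<beta>)"
    have "finite (S - {s0})" "card B < card (S - {s0})"
      using insert s0(1) by auto
    from insert.IH[OF this, of a'] obtain c where
      c: "\<exists>s\<in>S - {s0}. c s \<noteq> 0" "\<And>\<beta>. \<beta> \<in> B \<Longrightarrow> (\<Sum>s\<in>S - {s0}. c s * a' s \<beta>) = 0" by blast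
    define c0 where "c0 = - (\<Sum>s\<in>S - {s0}. c s * a s \<beta>0) / a s0 \<beta>0"
    have sum: "(\<Sum>s\<in>S. (c(s0 := c0)) s * a s \<beta>) = c0 * a s0 \<beta> + (\<Sum>s\<in>S - {s0}. c s * a s \<beta>)" for \<beta>
      using insert.prems(1) s0(1) by (subst sum.remove[of _ s0]) (auto intro!: sum.cong)
    have "(\<Sum>s\<in>S - {s0}. c s * a' s \<beta>) = (\<Sum>s\<in>S - {s0}. c s * a s \<beta>) + c0 * a s0 \<beta>" for \<beta>
      unfolding a'_def c0_def
      by (simp add: right_diff_distrib sum_subtractf sum_distrib_left sum_distrib_right sum_divide_distrib mult_ac)
    then have "(\<Sum>s\<in>S. (c(s0 := c0)) s * a s \<beta>) = 0" if "\<beta> \<in> insert \<beta>0 B" for \<beta>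
      using that c(2) s0(2) unfolding sum by (auto simp: c0_def add.commute)
    moreover have "\<exists>s\<in>S. (c(s0 := c0)) s \<noteq> 0" using c(1) by auto
    ultimately show ?thesis by blast
  qed
qed

section \<open>Tensor trains in unfolded coordinates\<close>

text \<open>
  For each \<open>i\<close> the matrices \<open>A i 1, \<dots>, A i (k i)\<close> are stacked into a single matrix with \<open>r i * k i\<close> rows:
  \<open>y (i, (j - 1) * r i + a, b)\<close> is the entry \<open>(a, b)\<close> of \<open>A i j\<close>.
  The row vector \<open>left_vec r y j i\<close> is the product of the first \<open>i\<close> matrices; its initial value \<open>1\<close> is only meaningful at \<open>b = 0\<close>, as \<open>r 0 = 1\<close>.
\<close>

type_synonym params = "nat \<times> nat \<times> nat \<Rightarrow> complex"

fun left_vec :: "(nat \<Rightarrow> nat) \<Rightarrow> params \<Rightarrow> (nat \<Rightarrow> nat) \<Rightarrow> nat \<Rightarrow> nat \<Rightarrow> complex" where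
  "left_vec r y j 0 b = 1"
| "left_vec r y j (Suc i) b = (\<Sum>a<r i. left_vec r y j i a * y (i, (j i - 1) * r i + a, b))"

lemma left_vec_agree: "(\<And>l. l < i \<Longrightarrow> j l = j' l) \<Longrightarrow> left_vec r y j i b = left_vec r y j' i b"
  by (induction i arbitrary: b) simp_all

lemma unfolded_row_less: "(j - 1) * r + a < r * k" if "j \<in> {1..k}" "a < r" for j r k a :: nat
proof -
  have "(j - 1) * r + a < (j - 1) * r + r" using that by simp
  also have "\<dots> = j * r" using that by (cases j) auto
  also have "\<dots> \<le> r * k" using that by simp
  finally show ?thesis .
qed

lemma left_vec_cong:
  assumes "\<And>l \<rho> b. l < i \<Longrightarrow> \<rho> < r l * k l \<Longrightarrow> b < r (Suc l) \<Longrightarrow> y (l, \<rho>, b) = y' (l, \<rho>, b)"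
    "\<And>l. l < i \<Longrightarrow> j l \<in> {1..k l}" "b < r i"
  shows "left_vec r y j i b = left_vec r y' j i b"
  using assms
proof (induction i arbitrary: b)
  case (Suc i)
  have "y (i, (j i - 1) * r i + a, b) = y' (i, (j i - 1) * r i + a, b)" if "a < r i" for a
    using Suc.prems unfolded_row_less[OF Suc.prems(2)[of i] that] by simp
  moreover have "left_vec r y j i a = left_vec r y' j i a" if "a < r i" for a
    using Suc.prems that by (intro Suc.IH) auto
  ultimately show ?case by (auto intro!: sum.cong)
qed simp

text \<open>A gauge change alters two neighbouring matrices only; this reduces its effect on the
  whole train to the row vector just behind them.\<close>

lemma left_vec_tail:
  assumes "\<And>b. b < r i0 \<Longrightarrow> left_vec r y j i0 b = left_vec r y' j i0 b"
    "\<And>l \<rho> b. i0 \<le> l \<Longrightarrow> y (l, \<rho>, b) = y' (l, \<rho>, b)" "i0 \<le> i" "b < r i"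
  shows "left_vec r y j i b = left_vec r y' j i b"
  using assms(3,4)
proof (induction i arbitrary: b rule: dec_induct)
  case base
  then show ?case using assms(1) by blast
next
  case (step i)
  then show ?case using assms(2) by (auto intro!: sum.cong)
qed

text \<open>The product is linear in each layer, so degrees add over the layers. Keeping one
  \<open>\<delta> l\<close> per layer gives degree 1 when a single layer varies.\<close>

lemma poly_fun_left_vec:
  assumes "\<And>l \<rho> b. l < i \<Longrightarrow> poly_fun (\<delta> l) (\<lambda>t. y t (l, \<rho>, b))"
  shows "poly_fun (\<Sum>l<i. \<delta> l) (\<lambda>t. left_vec r (y t) j i b)"
  using assms
proof (induction i arbitrary: b)
  case 0
  then show ?case by (simp add: poly_fun_const)
next
  case (Suc i)
  then show ?case by (auto intro!: poly_fun_sum poly_fun_mult)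
qed

lemma mat_chain_eq_left_vec:
  assumes "r 0 = 1" "\<And>i. i \<le> m \<Longrightarrow> A i (j i) \<in> carrier_mat (r i) (r (Suc i))"
    "\<And>i a b. i \<le> m \<Longrightarrow> a < r i \<Longrightarrow> b < r (Suc i) \<Longrightarrow> A i (j i) $$ (a, b) = y (i, (j i - 1) * r i + a, b)"
  shows "mat_chain A j m \<in> carrier_mat 1 (r (Suc m)) \<and>
    (\<forall>b<r (Suc m). mat_chain A j m $$ (0, b) = left_vec r y j (Suc m) b)"
  using assms(2,3)
proof (induction m)
  case 0
  then show ?case using assms(1) by auto
next
  case (Suc m)
  from Suc have IH: "mat_chain A j m \<in> carrier_mat 1 (r (Suc m))"
    "\<And>b. b < r (Suc m) \<Longrightarrow> mat_chain A j m $$ (0, b) = left_vec r y j (Suc m) b"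
    by auto
  have A: "A (Suc m) (j (Suc m)) \<in> carrier_mat (r (Suc m)) (r (Suc (Suc m)))"
    using Suc.prems(1) by simp
  have "mat_chain A j (Suc m) $$ (0, b) = left_vec r y j (Suc (Suc m)) b" if "b < r (Suc (Suc m))" for b
  proof -
    have "mat_chain A j (Suc m) $$ (0, b) =
        (\<Sum>a<r (Suc m). mat_chain A j m $$ (0, a) * A (Suc m) (j (Suc m)) $$ (a, b))"
      using IH(1) A that by (simp add: scalar_prod_def atLeast0LessThan)
    also have "\<dots> = left_vec r y j (Suc (Suc m)) b"
      unfolding left_vec.simps(2)[of r y j "Suc m"]
      using IH(2) Suc.prems(2)[of "Suc m"] that by (intro sum.cong) auto
    finally show ?thesis .
  qed
  moreover have "mat_chain A j (Suc m) \<in> carrier_mat 1 (r (Suc (Suc m)))"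
    using IH(1) A by simp
  ultimately show ?case by blast
qed

text \<open>The matrix \<open>B + t * 1\<close> is singular only if \<open>- t\<close> is an
  eigenvalue of \<open>B\<close>, and there are finitely many of those.\<close>

lemma perturbed_inverse:
  fixes B :: "nat \<Rightarrow> nat \<Rightarrow> complex"
  obtains X where "finite X" "\<And>t. t \<notin> X \<Longrightarrow> \<exists>C. \<forall>a<s. \<forall>b<s.
    (\<Sum>c<s. (B a c + t * of_bool (a = c)) * C c b) = of_bool (a = b) \<and>
    (\<Sum>c<s. C a c * (B c b + t * of_bool (c = b))) = of_bool (a = b)"
proof -
  define A where "A = mat s s (\<lambda>(a, b). B a b)"
  have A: "A \<in> carrier_mat s s" unfolding A_def by simp
  define X where "X = uminus ` {e. poly (char_poly A) e = 0}"
  have "char_poly A \<noteq> 0" using degree_monic_char_poly[OF A] by auto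
  then have "finite X" unfolding X_def using poly_roots_finite by blast
  moreover have "\<exists>C. \<forall>a<s. \<forall>b<s.
    (\<Sum>c<s. (B a c + t * of_bool (a = c)) * C c b) = of_bool (a = b) \<and>
    (\<Sum>c<s. C a c * (B c b + t * of_bool (c = b))) = of_bool (a = b)" if "t \<notin> X" for t
  proof -
    define M where "M = char_matrix A (- t)"
    have M: "M \<in> carrier_mat s s" unfolding M_def using A by simp
    have entry: "M $$ (a, b) = B a b + t * of_bool (a = b)" if "a < s" "b < s" for a b
      using that unfolding M_def char_matrix_def A_def by simp
    have "poly (char_poly A) (- t) \<noteq> 0"
      using that unfolding X_def by (metis (mono_tags) imageI mem_Collect_eq minus_minus)
    then have "Determinant.det M \<noteq> 0"
      unfolding M_def eigenvalue_root_char_poly[OF A, symmetric] eigenvalue_det[OF A] .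
    from det_non_zero_imp_unit[OF M this, of undefined] obtain C where
      C: "C \<in> carrier_mat s s" "C * M = 1\<^sub>m s" "M * C = 1\<^sub>m s"
      unfolding Units_def ring_mat_def by auto
    have "(\<Sum>c<s. (B a c + t * of_bool (a = c)) * C $$ (c, b)) = of_bool (a = b)" if "a < s" "b < s" for a b
    proof -
      have "(M * C) $$ (a, b) = (\<Sum>c<s. M $$ (a, c) * C $$ (c, b))"
        using M C(1) that by (simp add: scalar_prod_def atLeast0LessThan)
      then show ?thesis using C(3) that entry by (auto split: if_splits)
    qed
    moreover have "(\<Sum>c<s. C $$ (a, c) * (B c b + t * of_bool (c = b))) = of_bool (a = b)"
      if "a < s" "b < s" for a b
    proof -
      have "(C * M) $$ (a, b) = (\<Sum>c<s. C $$ (a, c) * M $$ (c, b))"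
        using M C(1) that by (simp add: scalar_prod_def atLeast0LessThan)
      then show ?thesis using C(2) that entry by (auto split: if_splits)
    qed
    ultimately show ?thesis by (intro exI[of _ "\<lambda>a b. C $$ (a, b)"]) blast
  qed
  ultimately show ?thesis using that by blast
qed

text \<open>The rank inequalities are extended to both ends of the train, where they only say that a
  product of positive numbers is at least 1. Later inductions then need no boundary cases.\<close>

locale tensor_train =
  fixes n :: nat and k r :: "nat \<Rightarrow> nat"
  assumes r_pos: "i \<le> Suc n \<Longrightarrow> r i > 0"
    and r_first: "r 0 = 1" and r_last: "r (Suc n) = 1"
    and r_left: "i \<le> n \<Longrightarrow> r (Suc i) \<le> r i * k i"
    and r_right: "i \<le> n \<Longrightarrow> r i \<le> r (Suc i) * k i"
begin

abbreviation "I \<equiv> tensor_indices n k"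

definition train :: "params \<Rightarrow> (nat \<Rightarrow> nat) \<Rightarrow> complex" where
  "train y = (\<lambda>j. if j \<in> I then left_vec r y j (Suc n) 0 else 0)"

lemma tensor_indicesD: "j \<in> I \<Longrightarrow> l \<le> n \<Longrightarrow> j l \<in> {1..k l}"
  unfolding tensor_indices_def by (auto dest: PiE_mem)

lemma tt_tensor_eq_train:
  assumes "\<And>i j. i \<le> n \<Longrightarrow> j \<in> {1..k i} \<Longrightarrow> A i j \<in> carrier_mat (r i) (r (Suc i))"
    "\<And>i j a b. i \<le> n \<Longrightarrow> j \<in> {1..k i} \<Longrightarrow> a < r i \<Longrightarrow> b < r (Suc i) \<Longrightarrow>
      A i j $$ (a, b) = y (i, (j - 1) * r i + a, b)"
  shows "tt_tensor n k A = train y"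
proof
  fix j
  show "tt_tensor n k A j = train y j"
  proof (cases "j \<in> I")
    case True
    have "mat_chain A j n $$ (0, 0) = left_vec r y j (Suc n) 0"
      using mat_chain_eq_left_vec[where r = r and A = A and j = j and m = n and y = y, OF r_first] assms
        tensor_indicesD[OF True] r_last by simp
    then show ?thesis using True unfolding tt_tensor_def train_def by simp
  qed (simp add: tt_tensor_def train_def)
qed

lemma tt_tensors_eq: "tt_tensors n k r = range train"
proof
  show "tt_tensors n k r \<subseteq> range train"
  proof
    fix T assume "T \<in> tt_tensors n k r"
    then obtain A where A: "T = tt_tensor n k A"
      "\<forall>i\<in>{0..n}. \<forall>j\<in>{1..k i}. A i j \<in> carrier_mat (r i) (r (i + 1))"
      unfolding tt_tensors_def by blast
    \<comment> \<open>This inverts the stacking: quotient and remainder of the row by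
      \<open>r i\<close> recover the matrix and its row. The shift by 1 occurs because tensor
      indices start at 1.\<close>
    have "tt_tensor n k A = train (\<lambda>(i, \<rho>, b). A i (\<rho> div r i + 1) $$ (\<rho> mod r i, b))"
      by (rule tt_tensor_eq_train) (use A(2) in auto)
    then show "T \<in> range train" using A(1) by blast
  qed
  show "range train \<subseteq> tt_tensors n k r"
  proof clarify
    fix y :: params
    let ?A = "\<lambda>i j. mat (r i) (r (Suc i)) (\<lambda>(a, b). y (i, (j - 1) * r i + a, b))"
    have "tt_tensor n k ?A = train y" by (rule tt_tensor_eq_train) auto
    then show "train y \<in> tt_tensors n k r"
      unfolding tt_tensors_def by (intro CollectI exI[of _ ?A]) auto
  qed
qed

lemma tt_variety_eq: "tt_variety n k r = proj_closure I (range train - {\<lambda>_. 0})"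
  unfolding tt_variety_def proj_closure_def tt_tensors_eq ..

lemma train_in_coord_space: "train y \<in> coord_space I"
  unfolding coord_space_def train_def by simp

text \<open>Elements of \<open>I\<close> are extensional functions, whereas index paths are built
  with arbitrary values beyond \<open>n\<close>.\<close>

lemma train_restrict:
  assumes "\<And>l. l \<le> n \<Longrightarrow> j l \<in> {1..k l}"
  shows "restrict j {0..n} \<in> I" "train y (restrict j {0..n}) = left_vec r y j (Suc n) 0"
proof -
  show I: "restrict j {0..n} \<in> I"
    using assms unfolding tensor_indices_def by auto
  have "left_vec r y (restrict j {0..n}) (Suc n) 0 = left_vec r y j (Suc n) 0"
    by (rule left_vec_agree) simp
  then show "train y (restrict j {0..n}) = left_vec r y j (Suc n) 0"
    using I unfolding train_def by simp
qed

lemma poly_fun_train: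
  assumes "\<And>l \<rho> b. l \<le> n \<Longrightarrow> poly_fun (\<delta> l) (\<lambda>t. y t (l, \<rho>, b))"
  shows "poly_fun (\<Sum>l\<le>n. \<delta> l) (\<lambda>t. train (y t) j)"
proof (cases "j \<in> I")
  case True
  have "poly_fun (\<Sum>l<Suc n. \<delta> l) (\<lambda>t. left_vec r (y t) j (Suc n) 0)"
    by (rule poly_fun_left_vec) (use assms in simp)
  then show ?thesis using True unfolding train_def lessThan_Suc_atMost by simp
qed (simp add: train_def poly_fun_const)

text \<open>
  For \<open>i = n\<close> the block normalised here is a single entry, so that its normalisation fixes the scaling of the tensor.
\<close>

definition normal :: "nat \<Rightarrow> params \<Rightarrow> bool" where
  "normal m y \<longleftrightarrow> (\<forall>i<m. \<forall>\<rho><r (Suc i). \<forall>b<r (Suc i). y (i, \<rho>, b) = of_bool (\<rho> = b))"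

section \<open>The affine space of gauge-fixed parameters\<close>

definition free :: "(nat \<times> nat \<times> nat) set" where
  "free = (SIGMA i:{..n}. {r (Suc i)..<r i * k i} \<times> {..<r (Suc i)})"

definition pivot :: params where
  "pivot = (\<lambda>(i, \<rho>, b). of_bool (\<rho> = b))"

text \<open>Triples that no train reads are fixed as well, so this is an affine space whose
  dimension is exactly \<open>card free\<close>.\<close>

definition normal_params :: "params set" where
  "normal_params = {y. \<forall>q. q \<notin> free \<longrightarrow> y q = pivot q}"

lemma finite_free: "finite free"
  unfolding free_def by (intro finite_SigmaI) auto

lemma card_free: "card free = (\<Sum>i\<le>n. (r i * k i - r (Suc i)) * r (Suc i))"
  unfolding free_def by (simp add: card_cartesian_product)

lemma normal_params_pivot:
  assumes "y \<in> normal_params" "\<rho> < r (Suc i)"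
  shows "y (i, \<rho>, b) = of_bool (\<rho> = b)"
  using assms unfolding normal_params_def free_def pivot_def by auto

lemma mod_div_bounds:
  assumes "l \<le> n" "\<rho> < r l * k l"
  shows "\<rho> mod r l < r l" "\<rho> div r l + 1 \<in> {1..k l}"
proof -
  show "\<rho> mod r l < r l" using r_pos assms(1) by simp
  have "\<rho> div r l < k l" using assms(2) by (simp add: less_mult_imp_div_less mult.commute)
  then show "\<rho> div r l + 1 \<in> {1..k l}" by simp
qed

text \<open>Since \<open>a < r i \<le> r (i - 1) * k (i - 1)\<close> for positive \<open>i\<close>,
  row \<open>a\<close> of the preceding stacked matrix exists and is normalised to a unit vector.
  Quotient and remainder of \<open>a\<close> by \<open>r (i - 1)\<close> tell which matrix to select
  and which unit vector must enter it.\<close>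

lemma left_path:
  assumes "i \<le> Suc n" "a < r i"
  shows "\<exists>j. (\<forall>l<i. j l \<in> {1..k l}) \<and>
    (\<forall>y\<in>normal_params. \<forall>b<r i. left_vec r y j i b = of_bool (b = a))"
  using assms
proof (induction i arbitrary: a)
  case 0
  then show ?case using r_first by auto
next
  case (Suc i)
  have a: "a < r i * k i" using Suc.prems r_left[of i] by simp
  note ia = mod_div_bounds[OF _ a]
  obtain j where j: "\<And>l. l < i \<Longrightarrow> j l \<in> {1..k l}"
    "\<And>y b. y \<in> normal_params \<Longrightarrow> b < r i \<Longrightarrow> left_vec r y j i b = of_bool (b = a mod r i)"
    using Suc.IH[of "a mod r i"] ia(1) Suc.prems(1) by auto
  define j' where "j' = j(i := a div r i + 1)"
  have "left_vec r y j' (Suc i) b = of_bool (b = a)" if "y \<in> normal_params" "b < r (Suc i)" for y b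
  proof -
    have "left_vec r y j' i c = of_bool (c = a mod r i)" if "c < r i" for c
    proof -
      have "left_vec r y j' i c = left_vec r y j i c"
        unfolding j'_def by (rule left_vec_agree) simp
      then show ?thesis using j(2)[OF \<open>y \<in> normal_params\<close> that] by simp
    qed
    then have "left_vec r y j' (Suc i) b =
        (\<Sum>c<r i. of_bool (c = a mod r i) * y (i, (a div r i) * r i + c, b))"
      by (auto simp: j'_def intro!: sum.cong)
    also have "\<dots> = (\<Sum>c<r i. if c = a mod r i then y (i, (a div r i) * r i + c, b) else 0)"
      by (intro sum.cong) auto
    also have "\<dots> = y (i, a, b)"
      using ia(1) Suc.prems(1) by simp
    also have "\<dots> = of_bool (b = a)"
      using normal_params_pivot[OF that(1) Suc.prems(2)] by auto
    finally show ?thesis .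
  qed
  moreover have "j' l \<in> {1..k l}" if "l < Suc i" for l
    using that j(1) ia(2) Suc.prems(1) unfolding j'_def by auto
  ultimately show ?case by blast
qed

lemma train_nonzero:
  assumes "y \<in> normal_params"
  shows "train y \<noteq> (\<lambda>_. 0)"
proof -
  obtain j where j: "\<And>l. l < Suc n \<Longrightarrow> j l \<in> {1..k l}" "left_vec r y j (Suc n) 0 = 1"
    using left_path[of "Suc n" 0] r_last assms by auto
  have "train y (restrict j {0..n}) = 1" using train_restrict(2)[of j y] j by auto
  then show ?thesis by auto
qed

subsection \<open>Density of the normalised tensor trains\<close>

text \<open>If the top block of layer \<open>m\<close> is invertible, its inverse is multiplied into
  layer \<open>m\<close> and the block itself into layer \<open>m + 1\<close>, which normalises
  layer \<open>m\<close> without changing the tensor. A general block becomes invertible after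
  adding almost any multiple \<open>t\<close> of the identity, and \<open>f\<close> is polynomial in
  \<open>t\<close>.\<close>

lemma gauge_step:
  assumes f: "form I K f" and m: "m \<le> n" and y: "normal m y"
    and zero: "\<And>y. normal (Suc m) y \<Longrightarrow> f (train y) = 0"
  shows "f (train y) = 0"
proof -
  define s where "s = r (Suc m)"
  define z where "z = (\<lambda>t (i, \<rho>, b). y (i, \<rho>, b) + t * of_bool (i = m \<and> \<rho> = b))"
  obtain X where X: "finite X" "\<And>t. t \<notin> X \<Longrightarrow> \<exists>C. \<forall>a<s. \<forall>b<s.
    (\<Sum>c<s. (y (m, a, c) + t * of_bool (a = c)) * C c b) = of_bool (a = b) \<and>
    (\<Sum>c<s. C a c * (y (m, c, b) + t * of_bool (c = b))) = of_bool (a = b)"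
    using perturbed_inverse[of s "\<lambda>a b. y (m, a, b)"] by blast
  have "f (train (z t)) = 0" if t: "t \<notin> X" for t
  proof -
    obtain C where "\<forall>a<s. \<forall>b<s.
        (\<Sum>c<s. (y (m, a, c) + t * of_bool (a = c)) * C c b) = of_bool (a = b) \<and>
        (\<Sum>c<s. C a c * (y (m, c, b) + t * of_bool (c = b))) = of_bool (a = b)"
      using X(2)[OF t] by blast
    then have C: "(\<Sum>c<s. z t (m, a, c) * C c b) = of_bool (a = b)"
      "(\<Sum>c<s. C a c * z t (m, c, b)) = of_bool (a = b)" if "a < s" "b < s" for a b
      using that unfolding z_def by auto
    \<comment> \<open>Layer \<open>m\<close> is multiplied by \<open>C\<close> on the right, and
      each matrix of layer \<open>m + 1\<close> by the block on the left. Stacked rows of layer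
      \<open>m + 1\<close> split by \<open>s\<close>, its number of rows per matrix.\<close>
    define w where "w = (\<lambda>(i, \<rho>, b).
      if i = m then \<Sum>c<s. z t (m, \<rho>, c) * C c b
      else if i = Suc m then \<Sum>c<s. z t (m, \<rho> mod s, c) * z t (i, (\<rho> div s) * s + c, b)
      else z t (i, \<rho>, b))"
    have "normal (Suc m) w"
      unfolding normal_def
    proof (intro allI impI)
      fix i \<rho> b assume i: "i < Suc m" "\<rho> < r (Suc i)" "b < r (Suc i)"
      show "w (i, \<rho>, b) = of_bool (\<rho> = b)"
      proof (cases "i = m")
        case True
        then show ?thesis using C(1) i unfolding w_def s_def by simp
      next
        case False
        then show ?thesis using y i unfolding w_def z_def normal_def by auto
      qed
    qed
    then have fw: "f (train w) = 0" by (rule zero)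
    have below: "left_vec r w j m a = left_vec r (z t) j m a" if "j \<in> I" "a < r m" for j a
      using that m tensor_indicesD by (intro left_vec_cong[where k = k]) (auto simp: w_def)
    have at: "left_vec r w j (Suc m) b = (\<Sum>c<s. left_vec r (z t) j (Suc m) c * C c b)"
      if j: "j \<in> I" for j b
    proof -
      have "left_vec r w j (Suc m) b = (\<Sum>a<r m. left_vec r (z t) j m a *
          (\<Sum>c<s. z t (m, (j m - 1) * r m + a, c) * C c b))"
        using below[OF j] by (auto simp: w_def intro!: sum.cong)
      also have "\<dots> = (\<Sum>a<r m. \<Sum>c<s. left_vec r (z t) j m a * z t (m, (j m - 1) * r m + a, c) * C c b)"
        by (simp add: sum_distrib_left mult.assoc)
      also have "\<dots> = (\<Sum>c<s. left_vec r (z t) j (Suc m) c * C c b)"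
        by (subst sum.swap) (simp add: sum_distrib_right)
      finally show ?thesis .
    qed
    show "f (train (z t)) = 0"
    \<comment> \<open>After the last layer no neighbour can absorb the block. There it amounts to a
      nonzero scalar, which homogeneity of \<open>f\<close> removes.\<close>
    proof (cases "m = n")
      case True
      then have s: "s = 1" unfolding s_def using r_last by simp
      have "train w = (\<lambda>j. C 0 0 * train (z t) j)"
      proof
        fix j
        show "train w j = C 0 0 * train (z t) j"
          using at[of j 0] True unfolding train_def s by (simp del: left_vec.simps)
      qed
      then have "C 0 0 ^ K * f (train (z t)) = 0"
        using fw form_homogeneous[OF f] by simp
      moreover have "C 0 0 \<noteq> 0" using C(1)[of 0 0] s by auto
      ultimately show ?thesis by simp
    next
      case False
      have above: "left_vec r w j (Suc (Suc m)) b = left_vec r (z t) j (Suc (Suc m)) b"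
        if j: "j \<in> I" for j b
      proof -
        define v where "v = left_vec r (z t) j (Suc m)"
        define x where "x = (\<lambda>c. z t (Suc m, (j (Suc m) - 1) * s + c, b))"
        have "w (Suc m, (j (Suc m) - 1) * s + a, b) = (\<Sum>c<s. z t (m, a, c) * x c)" if "a < s" for a
          using that unfolding w_def x_def by simp
        then have "left_vec r w j (Suc (Suc m)) b =
            (\<Sum>a<s. (\<Sum>d<s. v d * C d a) * (\<Sum>c<s. z t (m, a, c) * x c))"
          unfolding left_vec.simps(2)[of r w j "Suc m"] at[OF j] v_def s_def[symmetric]
          by (intro sum.cong) auto
        also have "\<dots> = (\<Sum>a<s. \<Sum>d<s. \<Sum>c<s. v d * C d a * (z t (m, a, c) * x c))"
          by (simp add: sum_product)
        also have "\<dots> = (\<Sum>d<s. \<Sum>c<s. \<Sum>a<s. v d * C d a * (z t (m, a, c) * x c))"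
          by (subst sum.swap) (intro sum.cong refl sum.swap)
        also have "\<dots> = (\<Sum>d<s. \<Sum>c<s. v d * (\<Sum>a<s. C d a * z t (m, a, c)) * x c)"
          by (simp add: sum_distrib_left sum_distrib_right mult.assoc)
        \<comment> \<open>Here \<open>C\<close> meets the block from the other side and both
          cancel.\<close>
        also have "\<dots> = (\<Sum>d<s. \<Sum>c<s. if c = d then v d * x c else 0)"
          by (intro sum.cong refl) (auto simp: C(2))
        also have "\<dots> = (\<Sum>d<s. v d * x d)" by simp
        also have "\<dots> = left_vec r (z t) j (Suc (Suc m)) b"
          unfolding left_vec.simps(2)[of r "z t" j "Suc m"] v_def x_def s_def ..
        finally show ?thesis .
      qed
      have "left_vec r w j (Suc n) 0 = left_vec r (z t) j (Suc n) 0" if "j \<in> I" for j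
        by (rule left_vec_tail[OF above[OF that]]) (use m False r_last in \<open>auto simp: w_def\<close>)
      then have "train w = train (z t)" unfolding train_def by auto
      then show ?thesis using fw by simp
    qed
  qed
  moreover have "poly_fun 1 (\<lambda>t. z t (l, \<rho>, b))" for l \<rho> b
    using poly_fun_linear[of 0 "y (l, \<rho>, b)" "of_bool (l = m \<and> \<rho> = b)"]
    unfolding z_def by (simp only: prod.case One_nat_def)
  then have "poly_fun ((\<Sum>l\<le>n. 1) * K) (\<lambda>t. f (train (z t)))"
    by (intro poly_fun_form[OF f] poly_fun_train)
  ultimately have "f (train (z 0)) = 0" using poly_fun_zero_cofinite X(1) by blast
  moreover have "z 0 = y" unfolding z_def by auto
  ultimately show ?thesis by simp
qed

text \<open>The normalisation is undone layer by layer with \<open>gauge_step\<close>, descending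
  from \<open>normal (Suc n)\<close> to \<open>normal 0\<close>, which imposes nothing.\<close>

lemma form_zero_on_trains:
  assumes f: "form I K f" and zero: "\<And>y. y \<in> normal_params \<Longrightarrow> f (train y) = 0"
  shows "f (train y) = 0"
proof -
  have full: "f (train y) = 0" if "normal (Suc n) y" for y
  proof -
    \<comment> \<open>Only entries that no train reads are changed.\<close>
    define y' where "y' = (\<lambda>q. if q \<in> free then y q else pivot q)"
    have "y (l, \<rho>, b) = y' (l, \<rho>, b)" if "l < Suc n" "\<rho> < r l * k l" "b < r (Suc l)" for l \<rho> b
      using \<open>normal (Suc n) y\<close> that unfolding y'_def free_def pivot_def normal_def by auto
    then have "left_vec r y j (Suc n) 0 = left_vec r y' j (Suc n) 0" if "j \<in> I" for j
      using tensor_indicesD[OF that] r_last by (intro left_vec_cong[where k = k]) auto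
    then have "train y = train y'" unfolding train_def by auto
    moreover have "y' \<in> normal_params" unfolding normal_params_def y'_def by simp
    ultimately show ?thesis using zero by simp
  qed
  have "\<forall>y. normal m y \<longrightarrow> f (train y) = 0" if "m \<le> Suc n" for m
    using that
  proof (induction m rule: inc_induct)
    case base
    then show ?case using full by blast
  next
    case (step m)
    then show ?case using gauge_step[OF f, of m] by auto
  qed
  from this[of 0] show ?thesis unfolding normal_def by simp
qed

subsection \<open>The dimension\<close>

lemma trains_subset: "range train - {\<lambda>_. 0} \<subseteq> coord_space I - {\<lambda>_. 0}"
  using train_in_coord_space by blast

text \<open>With more forms than grid points, some nontrivial combination vanishes on the grid,
  hence on all normalised trains, hence on the variety.\<close>

lemma indep_forms_bound:
  assumes "indep_forms I K (\<Union>(tt_variety n k r)) m"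
  shows "m \<le> Suc K ^ card free"
proof (rule ccontr)
  assume m: "\<not> m \<le> Suc K ^ card free"
  obtain G where G: "\<And>s. s < m \<Longrightarrow> form I K (G s)"
    "\<And>c. (\<forall>v\<in>\<Union>(tt_variety n k r). (\<Sum>s<m. c s * G s v) = 0) \<Longrightarrow> \<forall>s<m. c s = 0"
    using assms unfolding indep_forms_def by blast
  define X :: "complex set" where "X = of_nat ` {..K}"
  have X: "finite X" "card X = Suc K"
    unfolding X_def by (auto simp: card_image inj_on_def)
  define grid where "grid = (\<lambda>z q. if q \<in> free then z q else pivot q) ` (free \<rightarrow>\<^sub>E X)"
  have "finite (free \<rightarrow>\<^sub>E X)" using X finite_free by (intro finite_PiE) auto
  then have grid: "finite grid" "card grid \<le> Suc K ^ card free"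
    unfolding grid_def using card_image_le[of "free \<rightarrow>\<^sub>E X"] X finite_free by (auto simp: card_PiE)
  obtain c where c: "\<exists>s<m. c s \<noteq> 0"
    "\<And>y. y \<in> grid \<Longrightarrow> (\<Sum>s<m. c s * G s (train y)) = 0"
    using nontrivial_solution[of grid "{..<m}" "\<lambda>s y. G s (train y)"] grid m by auto
  define g where "g = (\<lambda>v. \<Sum>s<m. c s * G s v)"
  have g: "form I K g" unfolding g_def by (rule form_sum) (simp add: G(1))
  have "g (train y) = 0" if "y \<in> normal_params" for y
  proof (rule zero_on_grid[of free K "\<lambda>y. g (train y)" X pivot])
    fix q :: "nat \<times> nat \<times> nat" and y assume "q \<in> free"
    obtain i \<rho> b where q: "q = (i, \<rho>, b)" by (cases q)
    \<comment> \<open>A single parameter occurs in one layer only, so the tensor is affine in it and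
      \<open>g\<close> has degree at most \<open>K\<close> in it.\<close>
    have "poly_fun (\<Sum>l\<le>n. of_bool (l = i)) (\<lambda>t. train (y(q := t)) j)" for j
    proof (rule poly_fun_train)
      fix l \<rho>' b'
      show "poly_fun (of_bool (l = i)) (\<lambda>t. (y(q := t)) (l, \<rho>', b'))"
        using poly_fun_linear[of 0 0 1] unfolding q
        by (cases "(l, \<rho>', b') = (i, \<rho>, b)") (auto simp: poly_fun_const)
    qed
    moreover have "(\<Sum>l\<le>n. of_bool (l = i)) \<le> (1 :: nat)"
      by (simp add: of_bool_def)
    ultimately have "poly_fun 1 (\<lambda>t. train (y(q := t)) j)" for j
      using poly_fun_mono by blast
    from poly_fun_form[OF g this] show "poly_fun K (\<lambda>t. g (train (y(q := t))))" by simp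
  next
    fix y assume y: "\<And>q. q \<in> free \<Longrightarrow> y q \<in> X" "\<And>q. q \<notin> free \<Longrightarrow> y q = pivot q"
    have "y \<in> grid"
      unfolding grid_def by (rule image_eqI[of _ _ "restrict y free"]) (use y in auto)
    then show "g (train y) = 0" unfolding g_def by (rule c(2))
  qed (use that X finite_free in \<open>auto simp: normal_params_def\<close>)
  then have "g (train y) = 0" for y using form_zero_on_trains[OF g] by blast
  then have "g v = 0" if "v \<in> \<Union>(tt_variety n k r)" for v
    using that form_zero_on_closure[OF trains_subset g] unfolding tt_variety_eq by blast
  then have "\<forall>s<m. c s = 0" unfolding g_def by (intro G(2)) blast
  then show False using c(1) by blast
qed

text \<open>
  The base point of the flag: the \<open>i\<close>-th matrix contains the identity both in the rows used for the gauge fixing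
  and, viewed as an \<open>r i \<times> (k i * r (i + 1))\<close> matrix, in the columns \<open>(c div r (i + 1), c mod r (i + 1))\<close>
  for \<open>c < r i\<close>.
\<close>

definition base :: params where
  "base = (\<lambda>(i, \<rho>, b). if (i, \<rho>, b) \<in> free
     then of_bool (\<rho> mod r i = (\<rho> div r i) * r (Suc i) + b) else pivot (i, \<rho>, b))"

lemma base_normal: "base \<in> normal_params"
  unfolding base_def normal_params_def by auto

text \<open>In free rows this is the definition of \<open>base\<close>, since quotient and remainder
  by \<open>r (Suc i)\<close> reassemble \<open>c\<close>. What needs proof is that the gauge-fixed
  rows do not conflict with it.\<close>

lemma base_column:
  assumes i: "i \<le> n" and a: "a < r i" and c: "c < r i"
  shows "base (i, (c div r (Suc i)) * r i + a, c mod r (Suc i)) = of_bool (a = c)"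
proof -
  define s where "s = r (Suc i)"
  define \<rho> where "\<rho> = (c div s) * r i + a"
  have s: "s > 0" unfolding s_def using r_pos i by simp
  have "c < k i * s" using c r_right[OF i] unfolding s_def by (simp add: mult.commute)
  then have "c div s < k i" by (rule less_mult_imp_div_less)
  then have \<rho>_less: "\<rho> < r i * k i"
    using unfolded_row_less[of "c div s + 1" "k i" a "r i"] a unfolding \<rho>_def by simp
  have \<rho>: "\<rho> mod r i = a" "\<rho> div r i = c div s" using a unfolding \<rho>_def by auto
  have "base (i, \<rho>, c mod s) = of_bool (a = c)"
  proof (cases "s \<le> \<rho>")
    case True
    then have "(i, \<rho>, c mod s) \<in> free" using i s \<rho>_less unfolding free_def s_def by auto
    then show ?thesis unfolding base_def using \<rho> s_def by simp
  next
    case False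
    then have "base (i, \<rho>, c mod s) = of_bool (\<rho> = c mod s)"
      unfolding base_def free_def pivot_def s_def by simp
    also have "(\<rho> = c mod s) = (a = c)"
    proof (cases "c < s")
      case True
      then show ?thesis unfolding \<rho>_def by simp
    next
      \<comment> \<open>This case is contradictory: \<open>\<rho> < s\<close>,
        \<open>s \<le> c\<close> and \<open>c < r i\<close> clash with
        \<open>r i \<le> \<rho>\<close>.\<close>
      case c_ge: False
      then have "c div s \<ge> 1" using s by (simp add: div_greater_zero_iff Suc_le_eq)
      then have "1 * r i \<le> (c div s) * r i" by (rule mult_le_mono1)
      then have "r i \<le> \<rho>" unfolding \<rho>_def by linarith
      moreover have "c mod s \<le> c" by simp
      moreover have "a \<le> \<rho>" unfolding \<rho>_def by simp
      ultimately show ?thesis using False c_ge c by auto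
    qed
    finally show ?thesis .
  qed
  then show ?thesis unfolding \<rho>_def s_def .
qed

text \<open>Mirror image of \<open>left_path\<close>: along the path the matrices from layer
  \<open>i\<close> on multiply to the unit column vector at \<open>c\<close>. The claim ranges over
  all \<open>j'\<close> and \<open>y\<close> with the given tail, so that any beginning can be
  attached.\<close>

lemma right_path:
  assumes "i \<le> Suc n" "c < r i"
  shows "\<exists>j. (\<forall>l\<in>{i..n}. j l \<in> {1..k l}) \<and> (\<forall>y j'. (\<forall>l\<in>{i..n}. j' l = j l) \<longrightarrow>
    (\<forall>l \<rho> b. i \<le> l \<longrightarrow> y (l, \<rho>, b) = base (l, \<rho>, b)) \<longrightarrow>
    left_vec r y j' (Suc n) 0 = left_vec r y j' i c)"
  using assms
proof (induction i arbitrary: c rule: inc_induct)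
  case base
  then show ?case using r_last by auto
next
  case (step i)
  define s where "s = r (Suc i)"
  have "s > 0" unfolding s_def using r_pos step by simp
  then have "c mod s < r (Suc i)" unfolding s_def by simp
  from step.IH[OF this] obtain j where j: "\<And>l. l \<in> {Suc i..n} \<Longrightarrow> j l \<in> {1..k l}"
    "\<And>y j'. (\<forall>l\<in>{Suc i..n}. j' l = j l) \<Longrightarrow>
      (\<forall>l \<rho> b. Suc i \<le> l \<longrightarrow> y (l, \<rho>, b) = base (l, \<rho>, b)) \<Longrightarrow>
      left_vec r y j' (Suc n) 0 = left_vec r y j' (Suc i) (c mod s)"
    by blast
  define j1 where "j1 = j(i := c div s + 1)"
  have "c < k i * s" using step r_right[of i] unfolding s_def by (simp add: mult.commute)
  then have "c div s < k i" by (rule less_mult_imp_div_less)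
  then have "j1 l \<in> {1..k l}" if "l \<in> {i..n}" for l
    using that j(1)[of l] unfolding j1_def by auto
  moreover have "left_vec r y j' (Suc n) 0 = left_vec r y j' i c"
    if j': "\<forall>l\<in>{i..n}. j' l = j1 l" and y: "\<forall>l \<rho> b. i \<le> l \<longrightarrow> y (l, \<rho>, b) = base (l, \<rho>, b)" for y j'
  proof -
    have "left_vec r y j' (Suc n) 0 = left_vec r y j' (Suc i) (c mod s)"
      by (rule j(2)) (use j' y j1_def in auto)
    also have "\<dots> = (\<Sum>a<r i. left_vec r y j' i a * base (i, (c div s) * r i + a, c mod s))"
      using j' y step by (auto simp: j1_def)
    also have "\<dots> = (\<Sum>a<r i. if a = c then left_vec r y j' i a else 0)"
      using step by (intro sum.cong refl) (auto simp: s_def base_column)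
    also have "\<dots> = left_vec r y j' i c" using step by simp
    finally show ?thesis .
  qed
  ultimately show ?case by blast
qed

text \<open>A left path brings the unit vector at \<open>\<rho> mod r i\<close> to layer
  \<open>i\<close>, index \<open>\<rho> div r i + 1\<close> selects the matrix there, and a right
  path reads off its column \<open>b\<close>.\<close>

lemma parameter_is_coordinate:
  assumes i: "i \<le> n" and \<rho>: "\<rho> < r i * k i" and b: "b < r (Suc i)"
  obtains x where "x \<in> I" "\<And>y. y \<in> normal_params \<Longrightarrow>
    (\<And>l \<rho> b. i < l \<Longrightarrow> y (l, \<rho>, b) = base (l, \<rho>, b)) \<Longrightarrow> train y x = y (i, \<rho>, b)"
proof -
  note i\<rho> = mod_div_bounds[OF i \<rho>]
  obtain j1 where j1: "\<And>l. l < i \<Longrightarrow> j1 l \<in> {1..k l}"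
    "\<And>y a. y \<in> normal_params \<Longrightarrow> a < r i \<Longrightarrow> left_vec r y j1 i a = of_bool (a = \<rho> mod r i)"
    using left_path[OF _ i\<rho>(1)] i by auto
  have "Suc i \<le> Suc n" using i by simp
  from right_path[OF this b] obtain j2 where j2: "\<And>l. l \<in> {Suc i..n} \<Longrightarrow> j2 l \<in> {1..k l}"
    "\<And>y j'. (\<forall>l\<in>{Suc i..n}. j' l = j2 l) \<Longrightarrow>
      (\<forall>l \<rho> b. Suc i \<le> l \<longrightarrow> y (l, \<rho>, b) = base (l, \<rho>, b)) \<Longrightarrow>
      left_vec r y j' (Suc n) 0 = left_vec r y j' (Suc i) b"
    by blast
  define j where "j = (\<lambda>l. if l < i then j1 l else if l = i then \<rho> div r i + 1 else j2 l)"
  have j: "j l \<in> {1..k l}" if "l \<le> n" for l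
    using that j1(1)[of l] j2(1)[of l] i\<rho>(2) unfolding j_def by auto
  show ?thesis
  proof (rule that[OF train_restrict(1)[OF j]])
    fix y assume y: "y \<in> normal_params" "\<And>l \<rho> b. i < l \<Longrightarrow> y (l, \<rho>, b) = base (l, \<rho>, b)"
    have "left_vec r y j i a = of_bool (a = \<rho> mod r i)" if "a < r i" for a
      using j1(2)[OF y(1) that] left_vec_agree[of i j j1 r y a] unfolding j_def by simp
    then have "left_vec r y j (Suc i) b =
        (\<Sum>a<r i. if a = \<rho> mod r i then y (i, (\<rho> div r i) * r i + a, b) else 0)"
      by (auto simp: j_def intro!: sum.cong)
    also have "\<dots> = y (i, \<rho>, b)" using i\<rho>(1) by simp
    also have "left_vec r y j (Suc i) b = left_vec r y j (Suc n) 0"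
      by (rule j2(2)[symmetric]) (use y(2) in \<open>auto simp: j_def\<close>)
    finally show "train y (restrict j {0..n}) = y (i, \<rho>, b)"
      using train_restrict(2)[OF j] by simp
  qed auto
qed

text \<open>Along the line through two points of \<open>Y\<close>, both forms become univariate
  polynomials with product zero, so one of them vanishes identically.\<close>

lemma prime_cone_trains:
  assumes "Y \<noteq> {}"
    and line: "\<And>y1 y2 t. y1 \<in> Y \<Longrightarrow> y2 \<in> Y \<Longrightarrow> (\<lambda>q. y1 q + t * (y2 q - y1 q)) \<in> Y"
  shows "prime_cone I (train ` Y)"
  unfolding prime_cone_def
proof (intro conjI allI impI)
  fix d e f g
  assume f: "form I d f" and g: "form I e g" and fg: "\<forall>v\<in>train ` Y. f v * g v = 0"
  show "(\<forall>v\<in>train ` Y. f v = 0) \<or> (\<forall>v\<in>train ` Y. g v = 0)"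
  proof (rule ccontr)
    assume "\<not> ?thesis"
    then obtain y1 y2 where y: "y1 \<in> Y" "f (train y1) \<noteq> 0" "y2 \<in> Y" "g (train y2) \<noteq> 0" by blast
    define z where "z = (\<lambda>t q. y1 q + t * (y2 q - y1 q))"
    have z: "z 0 = y1" "z 1 = y2" "\<And>t. z t \<in> Y"
      using line[OF y(1,3)] unfolding z_def by auto
    have "poly_fun (\<Sum>l\<le>n. 1) (\<lambda>t. train (z t) j)" for j
      by (rule poly_fun_train) (use poly_fun_linear[of 0] in \<open>auto simp: z_def\<close>)
    note poly_fun_form[OF f this] poly_fun_form[OF g this]
    then have "g (train (z 1)) = 0"
      by (rule poly_fun_mult_zero[where s = 0]) (use fg z y in auto)
    then show False using z(2) y(4) by simp
  qed
qed (use assms(1) in simp)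

lemma proj_dim_tt_variety: "proj_dim I (tt_variety n k r) = ereal (real (card free))"
proof (rule antisym)
  let ?V = "tt_variety n k r"
  have V: "closedin (zariski I) ?V" unfolding tt_variety_eq by (rule closedin_proj_closure)
  then show "proj_dim I ?V \<le> ereal (real (card free))"
    using indep_forms_bound by (rule proj_dim_le)
  obtain qs0 where "set qs0 = free" "distinct qs0"
    using finite_distinct_list[OF finite_free] by blast
  \<comment> \<open>Parameters are released in order of layers, so that all layers behind the
    current one are still at the base point.\<close>
  define qs where "qs = sort_key fst qs0"
  have qs: "set qs = free" "distinct qs" "sorted (map fst qs)" "length qs = card free"
    using \<open>set qs0 = free\<close> \<open>distinct qs0\<close> distinct_card[of qs0] unfolding qs_def by auto
  \<comment> \<open>At stage \<open>s\<close> the first \<open>s\<close> parameters of the list are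
    free and the others keep their base values.\<close>
  define Y where "Y = (\<lambda>s. {y \<in> normal_params. \<forall>l\<in>{s..<card free}. y (qs ! l) = base (qs ! l)})"
  have Y_later: "y (l, \<rho>, b) = base (l, \<rho>, b)"
    if y: "y \<in> Y (Suc s)" and s: "s < card free" "fst (qs ! s) < l" for y s l \<rho> b
  proof (cases "(l, \<rho>, b) \<in> free")
    case True
    then obtain p where p: "p < card free" "qs ! p = (l, \<rho>, b)"
      using qs(1,4) by (metis in_set_conv_nth)
    have "s < p"
    proof (rule ccontr)
      assume "\<not> s < p"
      then have "map fst qs ! p \<le> map fst qs ! s"
        using sorted_nth_mono[OF qs(3), of p s] s(1) qs(4) by simp
      then show False using p s qs(4) by simp
    qed
    then show ?thesis using y p(1) unfolding Y_def p(2)[symmetric] by auto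
  next
    case False
    then show ?thesis using y base_normal unfolding Y_def normal_params_def by auto
  qed
  have Y_mono: "Y s \<subseteq> Y (Suc s)" for s unfolding Y_def by auto
  have Y_base: "base \<in> Y s" for s unfolding Y_def using base_normal by blast
  have "\<exists>f. form I 1 f \<and> (\<forall>v\<in>train ` Y s. f v = 0) \<and> (\<exists>v\<in>train ` Y (Suc s). f v \<noteq> 0)"
    if s: "s < card free" for s
  proof -
    obtain i \<rho> b where q: "qs ! s = (i, \<rho>, b)" by (cases "qs ! s")
    have "(i, \<rho>, b) \<in> free" using qs(1,4) s q by (metis nth_mem)
    then have i: "i \<le> n" "\<rho> < r i * k i" "b < r (Suc i)" unfolding free_def by auto
    have b: "b < r i * k i" using i r_left[of i] by simp
    have later: "y (l, \<rho>, b) = base (l, \<rho>, b)" if "y \<in> Y (Suc s)" "i < l" for y l \<rho> b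
      using Y_later[OF that(1) s] that(2) q by simp
    have normal: "y \<in> normal_params" if "y \<in> Y (Suc s)" for y using that unfolding Y_def by simp
    obtain x where x: "x \<in> I" "\<And>y. y \<in> Y (Suc s) \<Longrightarrow> train y x = y (i, \<rho>, b)"
      using parameter_is_coordinate[OF i] normal later by metis
    \<comment> \<open>The entry \<open>(i, b, b)\<close> is gauge-fixed to 1, so this coordinate
      homogenises the equation saying that the parameter has its base value.\<close>
    obtain x0 where x0: "x0 \<in> I" "\<And>y. y \<in> Y (Suc s) \<Longrightarrow> train y x0 = y (i, b, b)"
      using parameter_is_coordinate[OF i(1) b i(3)] normal later by metis
    have x0_1: "train y x0 = 1" if "y \<in> Y (Suc s)" for y
      using x0(2)[OF that] normal_params_pivot[OF normal[OF that] i(3), of b] by simp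
    define f where "f = (\<lambda>v :: (nat \<Rightarrow> nat) \<Rightarrow> complex. v x + (- base (i, \<rho>, b)) * v x0)"
    have "form I 1 f"
      unfolding f_def by (intro form_add form_scale form_coordinate x(1) x0(1))
    moreover have "f (train y) = 0" if "y \<in> Y s" for y
    proof -
      have y: "y \<in> Y (Suc s)" using that Y_mono by blast
      have "y (qs ! s) = base (qs ! s)" using that s unfolding Y_def by auto
      then show ?thesis using x(2)[OF y] x0_1[OF y] q unfolding f_def by simp
    qed
    moreover have "\<exists>v\<in>train ` Y (Suc s). f v \<noteq> 0"
    proof -
      define y where "y = base((i, \<rho>, b) := base (i, \<rho>, b) + 1)"
      have "y \<in> normal_params"
        using base_normal \<open>(i, \<rho>, b) \<in> free\<close> unfolding y_def normal_params_def by auto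
      moreover have "qs ! l \<noteq> (i, \<rho>, b)" if "l \<in> {Suc s..<card free}" for l
        using that qs(2,4) s q[symmetric] by (auto simp: nth_eq_iff_index_eq)
      ultimately have y: "y \<in> Y (Suc s)" unfolding Y_def y_def by auto
      have "f (train y) = 1"
        using x(2)[OF y] x0_1[OF y] unfolding f_def y_def by simp
      then show ?thesis using y by (metis imageI zero_neq_one)
    qed
    ultimately show ?thesis by blast
  qed
  then obtain f where f: "\<And>s. s < card free \<Longrightarrow> form I 1 (f s)"
    "\<And>s v. s < card free \<Longrightarrow> v \<in> train ` Y s \<Longrightarrow> f s v = 0"
    "\<And>s. s < card free \<Longrightarrow> \<exists>v\<in>train ` Y (Suc s). f s v \<noteq> 0"
    by metis
  have subset: "train ` Y s \<subseteq> range train - {\<lambda>_. 0}" for s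
    using train_nonzero unfolding Y_def by auto
  have "prime_cone I (train ` Y s)" for s
  proof (rule prime_cone_trains)
    fix y1 y2 t assume "y1 \<in> Y s" "y2 \<in> Y s"
    then show "(\<lambda>q. y1 q + t * (y2 q - y1 q)) \<in> Y s"
      unfolding Y_def normal_params_def by auto
  qed (use Y_base in blast)
  moreover have "proj_class v \<in> ?V" if "v \<in> train ` Y s" for s v
    unfolding tt_variety_eq using proj_class_in_closure[OF trains_subset] subset that by blast
  ultimately show "ereal (real (card free)) \<le> proj_dim I ?V"
    using subset trains_subset Y_mono
    by (intro proj_dim_ge[where T = "\<lambda>s. train ` Y s" and f = f, OF V _ _ _ _ f]) blast+
qed

text \<open>The subtractions on natural numbers are exact by \<open>r_left\<close>. The layer
  \<open>n\<close> contributes \<open>r n * k n - 1\<close>, the source of the final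
  \<open>- 1\<close>.\<close>

lemma real_card_free:
  "real (card free) = (\<Sum>i<n. (real (r i) * real (k i) - real (r (i + 1))) * real (r (i + 1)))
     + real (r n) * real (k n) - 1"
proof -
  have "real (card free) = (\<Sum>i\<le>n. (real (r i) * real (k i) - real (r (Suc i))) * real (r (Suc i)))"
    unfolding card_free using r_left by (simp add: of_nat_diff)
  then show ?thesis unfolding lessThan_Suc_atMost[symmetric] using r_last by simp
qed

end

theorem corollary6p5:
  fixes n :: nat and k r :: "nat \<Rightarrow> nat"
  assumes "\<And>i. i \<in> {0..n} \<Longrightarrow> k i > 0"
    and "\<And>i. i \<in> {1..n} \<Longrightarrow> r i > 0"
    and "r 0 = 1" and "r (n + 1) = 1"
    and "\<And>i. i \<in> {1..n} \<Longrightarrow> r i \<le> r (i - 1) * k (i - 1)"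
    and "\<And>i. i \<in> {1..n} \<Longrightarrow> r i \<le> r (i + 1) * k i"
  shows "proj_dim (tensor_indices n k) (tt_variety n k r) =
    ereal ((\<Sum>i<n. (real (r i) * real (k i) - real (r (i + 1))) * real (r (i + 1)))
           + real (r n) * real (k n) - 1)"
proof -
  have pos: "r i > 0" if "i \<le> Suc n" for i
    using that assms(2)[of i] assms(3,4) by (cases "i = 0"; cases "i = Suc n") auto
  interpret tensor_train n k r
  proof
    fix i assume i: "i \<le> n"
    have k: "k i > 0" using assms(1) i by simp
    show "r (Suc i) \<le> r i * k i"
    proof (cases "i = n")
      case True
      then show ?thesis using assms(4) pos[of n] k by (simp add: Suc_le_eq)
    next
      case False
      then show ?thesis using assms(5)[of "Suc i"] i by simp
    qed
    show "r i \<le> r (Suc i) * k i"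
    proof (cases "i = 0")
      case True
      then show ?thesis using assms(3) pos[of "Suc 0"] k by (simp add: Suc_le_eq)
    next
      case False
      then show ?thesis using assms(6)[of i] i by simp
    qed
  qed (use pos assms(3,4) in auto)
  show ?thesis unfolding proj_dim_tt_variety real_card_free ..
qed

end
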